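(* Fix a class $j$, and let $q_j=E[Y^{(j)}]$, $\hat q_j=\frac1n\sum_{i=1}^n g(X_i,\hat\theta_j)$, $A_j=E\{w(X,\theta_j)g'(X,\theta_j)g'(X,\theta_j)^T\}$ and $B_j=E[g'(X,\theta_j)]$, in the setting described in the context. Then the asymptotic variance of $\hat q_j$ is $$\mathrm{AVar}(\hat q_j)=\frac1n\mathrm{Var}[g(X,\theta_j)]+\frac1r B_j^TA_j^{-1}B_j .$$
   Context: Setting. $(X,Y^{(j)}),(X_1,Y_1^{(j)}),(X_2,Y_2^{(j)}),\dots$ are i.i.d., $X$ a random feature vector in $\mathbb R^f$ and $Y^{(j)}\in\{0,1\}$ the indicator of membership in class $j$. For each $n$, all of $X_1,\dots,X_n$ are observed, but $Y_i^{(j)}$ is observed only for $i=1,\dots,r$ (labeled data), where $r=r(n)\le n$ and $r/n\to\gamma\in(0,1]$. Semiparametric model: $P(Y^{(j)}=1\mid X=t)=g(t,\theta_j)$, where $g(t,\theta)$ is a known parametric family and $\theta_j\in\mathbb R^p$ is an unknown parameter in the interior of the parameter set; the distribution of $X$ is arbitrary. $g'(t,\theta)$ is the (column) gradient of $g$ in $\theta$, and $w(t,\theta)=1/\{g(t,\theta)[1-g(t,\theta)]\}$. The estimator $\hat\theta_j$, computed from the labeled data, is a root of $0=\sum_{i=1}^r w(X_i,\hat\theta_j)\{Y_i^{(j)}-g(X_i,\hat\theta_j)\}g'(X_i,\hat\theta_j)$. Standing regularity conditions: $0<g<1$; $g(t,\cdot)$ is continuously differentiable on a convex neighborhood $U$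 of $\theta_j$ with $E\sup_{\theta\in U}\|g'(X,\theta)\|<\infty$; $A_j=E\{w(X,\theta_j)g'(X,\theta_j)g'(X,\theta_j)^T\}$ is finite and invertible; and the standard asymptotic linear representation of the weighted least squares estimator holds: $r^{1/2}(\hat\theta_j-\theta_j)-r^{-1/2}A_j^{-1}\sum_{i=1}^r w(X_i,\theta_j)\{Y_i^{(j)}-g(X_i,\theta_j)\}g'(X_i,\theta_j)\to0$ in probability. Asymptotic variance: if $n^{1/2}(T_n-\tau)$ converges in distribution to $N(0,V)$, the asymptotic variance of the estimator $T_n$ of $\tau$ is $V/n$, where $n\gamma$ is identified with $r$. Thus the claim means $n^{1/2}(\hat q_j-q_j)\to N(0,V)$ in distribution with $V=\mathrm{Var}[g(X,\theta_j)]+\gamma^{-1}B_j^TA_j^{-1}B_j$. *)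

theory Defs
  imports "HOL-Probability.Probability"
begin

definition gradient :: "('p::real_inner \<Rightarrow> real) \<Rightarrow> 'p \<Rightarrow> 'p" where
  "gradient f x = (THE D. GDERIV f x :> D)"

lemma gradient_eqI:
  assumes "GDERIV f x :> D"
  shows "gradient f x = D"
  unfolding gradient_def
proof (rule the_equality)
  fix D' assume "GDERIV f x :> D'"
  with assms have "(\<lambda>h. inner h D) = (\<lambda>h. inner h D')"
    unfolding gderiv_def by (rule has_derivative_unique)
  then have "inner (D' - D) D' = inner (D' - D) D"
    by metis
  then have "inner (D' - D) (D' - D) = 0"
    by (simp add: inner_diff_right)
  then show "D' = D" by simp
qed (fact assms)

definition weight :: "('f \<Rightarrow> 'p \<Rightarrow> real) \<Rightarrow> 'f \<Rightarrow> 'p \<Rightarrow> real" where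
  "weight g t \<theta> = 1 / (g t \<theta> * (1 - g t \<theta>))"

definition score :: "('f \<Rightarrow> 'p::real_inner \<Rightarrow> real) \<Rightarrow> 'f \<Rightarrow> real \<Rightarrow> 'p \<Rightarrow> 'p" where
  "score g t y \<theta> = (weight g t \<theta> * (y - g t \<theta>)) *\<^sub>R gradient (g t) \<theta>"

definition info_integrand :: "('f \<Rightarrow> real^'p::finite \<Rightarrow> real) \<Rightarrow> 'f \<Rightarrow> real^'p \<Rightarrow> real^'p^'p" where
  "info_integrand g t \<theta> = weight g t \<theta> *\<^sub>R
     (\<chi> k l. gradient (g t) \<theta> $ k * gradient (g t) \<theta> $ l)"

definition conv_in_prob_zero :: "'a measure \<Rightarrow> (nat \<Rightarrow> 'a \<Rightarrow> 'b::real_normed_vector) \<Rightarrow> bool" where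
  "conv_in_prob_zero M Z \<longleftrightarrow>
     (\<forall>\<epsilon>>0. (\<lambda>n. measure M {\<omega> \<in> space M. norm (Z n \<omega>) > \<epsilon>}) \<longlonglongrightarrow> 0)"

text \<open>The normal law with mean \<open>\<mu>\<close> and variance \<open>v \<ge> 0\<close>, as an affine image of the standard
  normal law, so that \<open>v = 0\<close> gives the point mass at \<open>\<mu>\<close>
  (\<open>normal_density \<mu> 0\<close> is identically zero and would not give a probability measure).\<close>

definition normal_law :: "real \<Rightarrow> real \<Rightarrow> real measure" where
  "normal_law \<mu> v = distr std_normal_distribution borel (\<lambda>x. \<mu> + sqrt v * x)"

lemma normal_law_pos:
  assumes "v > 0"
  shows "normal_law \<mu> v = density lborel (normal_density \<mu> (sqrt v))"
proof -
  interpret N: real_distribution std_normal_distribution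
    by (rule real_dist_normal_dist)
  have "distributed std_normal_distribution lborel (\<lambda>x. x) std_normal_density"
    unfolding distributed_def by (simp add: distr_id2)
  from N.normal_density_affine[OF this, of "sqrt v" \<mu>] assms
  have "distributed std_normal_distribution lborel (\<lambda>x. \<mu> + sqrt v * x)
          (normal_density \<mu> (sqrt v))"
    by simp
  then show ?thesis
    unfolding distributed_def normal_law_def by (simp cong: distr_cong)
qed

lemma normal_law_zero: "normal_law \<mu> 0 = return borel \<mu>"
proof -
  interpret N: real_distribution std_normal_distribution
    by (rule real_dist_normal_dist)
  show ?thesis
    unfolding normal_law_def by (simp add: N.distr_const)
qed

text \<open>The sequence \<open>a\<close> is the asymptotic variance of the estimators \<open>T n\<close> of \<open>\<tau>\<close>:
  \<open>a n = V / n\<close>, where \<open>sqrt n * (T n - \<tau>)\<close> converges in distribution to the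
  normal law with mean 0 and variance \<open>V\<close>.\<close>

definition has_asymptotic_variance ::
    "'a measure \<Rightarrow> (nat \<Rightarrow> 'a \<Rightarrow> real) \<Rightarrow> real \<Rightarrow> (nat \<Rightarrow> real) \<Rightarrow> bool" where
  "has_asymptotic_variance M T \<tau> a \<longleftrightarrow>
     (\<exists>V\<ge>0. (\<forall>n. a n = V / real n) \<and>
        weak_conv_m (\<lambda>n. distr M borel (\<lambda>\<omega>. sqrt (real n) * (T n \<omega> - \<tau>))) (normal_law 0 V))"

end

(*
  With N = sqrt n (qhat - q), a first-order expansion of g in the parameter gives
    N = n^(-1/2) sum_(i<=n) (g(X_i, theta) - q) + B^T (sqrt n (thetahat - theta)) + o_P(1),
  because the modulus of continuity of g' on a shrinking ball has vanishing expectation. Inserting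
  the linear representation of thetahat turns the second term into gamma^(-1) n^(-1/2) times the sum
  of B^T A^(-1) score_i over i <= r. The result is a sum of independent variables with one law for
  i <= r and another for r < i <= n; the score has conditional mean 0 given X, so it is uncorrelated
  with g(X, theta), and the product of the two characteristic functions converges to that of the
  claimed normal law.
*)
theory Submission
  imports Defs
begin

section \<open>Characteristic functions and Slutsky's theorem\<close>

text \<open>The obstacle is that the fitted parameter depends on the labeled pairs, so the terms
  \<open>g (X i \<omega>) (\<theta>hat n \<omega>)\<close> are not independent and no law of large
  numbers applies to them directly. The Taylor remainder is therefore divided by the distance from
  \<open>\<theta>hat\<close> to \<open>\<theta>\<close> and bounded by a modulus of continuity that
  depends on \<open>X i\<close> alone. Since g' is dominated near \<open>\<theta>\<close> only in
  first moment, this modulus is handled by Markov's inequality. All other estimates are of second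
  order: w is at least 1, so finiteness of A makes g'(X, \<theta>) square integrable, and
  Chebyshev's inequality suffices for averages. The exact coefficient of the score sum involves n /
  r. Replacing it by 1 / \<gamma>, at a cost of o_P(1), makes the summand of each block a fixed
  function of the sample pair, so that the characteristic function is a product of two powers. These
  powers have exponents r and n - r, both growing at most linearly, and the case \<gamma> = 1 needs
  no separate argument.\<close>

text \<open>Cross terms vanish: a new summand is centred and independent of the sum of the
  others.\<close>

lemma (in prob_space) expectation_square_sum_indep:
  fixes Z :: "'i \<Rightarrow> 'a \<Rightarrow> real"
  assumes "finite I" "indep_vars (\<lambda>_. borel) Z I"
    and "\<And>i. i \<in> I \<Longrightarrow> integrable M (\<lambda>\<omega>. (Z i \<omega>)\<^sup>2)"
    and "\<And>i. i \<in> I \<Longrightarrow> expectation (Z i) = 0"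
  shows "integrable M (\<lambda>\<omega>. (\<Sum>i\<in>I. Z i \<omega>)\<^sup>2)"
    and "expectation (\<lambda>\<omega>. (\<Sum>i\<in>I. Z i \<omega>)\<^sup>2) = (\<Sum>i\<in>I. expectation (\<lambda>\<omega>. (Z i \<omega>)\<^sup>2))"
proof -
  have "integrable M (\<lambda>\<omega>. (\<Sum>i\<in>I. Z i \<omega>)\<^sup>2) \<and>
    expectation (\<lambda>\<omega>. (\<Sum>i\<in>I. Z i \<omega>)\<^sup>2) = (\<Sum>i\<in>I. expectation (\<lambda>\<omega>. (Z i \<omega>)\<^sup>2))"
    using assms
  proof (induction I rule: finite_induct)
    case empty
    then show ?case by simp
  next
    case (insert i I)
    have meas: "random_variable borel (Z j)" if "j \<in> insert i I" for j
      using insert.prems(1) that by (auto simp: indep_vars_def)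
    have int: "integrable M (Z j)" if "j \<in> insert i I" for j
      using square_integrable_imp_integrable[OF meas[OF that] insert.prems(2)[OF that]] .
    let ?S = "\<lambda>\<omega>. \<Sum>j\<in>I. Z j \<omega>"
    have "indep_vars (\<lambda>_. borel) Z I"
      using insert.prems(1) by (rule indep_vars_subset) auto
    then have IH: "integrable M (\<lambda>\<omega>. (?S \<omega>)\<^sup>2)"
      "expectation (\<lambda>\<omega>. (?S \<omega>)\<^sup>2) = (\<Sum>i\<in>I. expectation (\<lambda>\<omega>. (Z i \<omega>)\<^sup>2))"
      using insert.IH insert.prems by auto
    have ind: "indep_var borel (Z i) borel ?S"
      using insert.hyps insert.prems(1) by (intro indep_vars_sum) auto
    have intS: "integrable M ?S" using int by auto
    have intP: "integrable M (\<lambda>\<omega>. Z i \<omega> * ?S \<omega>)"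
      using indep_var_integrable[OF ind] int intS by auto
    have "expectation (\<lambda>\<omega>. Z i \<omega> * ?S \<omega>) = expectation (Z i) * expectation ?S"
      using indep_var_lebesgue_integral[OF ind] int intS by auto
    then have P0: "expectation (\<lambda>\<omega>. Z i \<omega> * ?S \<omega>) = 0"
      using insert.prems(3) by simp
    have eq: "(\<lambda>\<omega>. (\<Sum>j\<in>insert i I. Z j \<omega>)\<^sup>2) =
       (\<lambda>\<omega>. (Z i \<omega>)\<^sup>2 + (?S \<omega>)\<^sup>2 + 2 * (Z i \<omega> * ?S \<omega>))"
      using insert.hyps by (simp add: power2_sum fun_eq_iff)
    show ?case
      unfolding eq using IH intP P0 insert.prems(2) insert.hyps by simp
  qed
  then show "integrable M (\<lambda>\<omega>. (\<Sum>i\<in>I. Z i \<omega>)\<^sup>2)"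
    "expectation (\<lambda>\<omega>. (\<Sum>i\<in>I. Z i \<omega>)\<^sup>2) = (\<Sum>i\<in>I. expectation (\<lambda>\<omega>. (Z i \<omega>)\<^sup>2))" by auto
qed

text \<open>Central limit theorem with an exponent \<open>m n\<close> that is only asymptotically
  \<rho> n, so that it can be applied to each block of a sum separately. The power is compared with
  that of \<open>exp (- c / n)\<close>, where c = t^2 v / 2, because the powers of this comparison
  factor converge without any estimate.\<close>

lemma (in prob_space) char_power_tendsto:
  fixes W :: "'a \<Rightarrow> real" and m :: "nat \<Rightarrow> nat"
  assumes [measurable]: "random_variable borel W"
    and sq: "integrable M (\<lambda>\<omega>. (W \<omega>)\<^sup>2)" and mean: "expectation W = 0"
    and m: "(\<lambda>n. real (m n) / real n) \<longlonglongrightarrow> \<rho>" and mn: "\<And>n. m n \<le> n"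
  shows "(\<lambda>n. char (distr M borel W) (t / sqrt (real n)) ^ m n) \<longlonglongrightarrow>
      complex_of_real (exp (- (t\<^sup>2 * (\<rho> * expectation (\<lambda>\<omega>. (W \<omega>)\<^sup>2)) / 2)))"
proof -
  interpret D: real_distribution "distr M borel W"
    by (rule real_distribution_distr) simp
  define v where "v = expectation (\<lambda>\<omega>. (W \<omega>)\<^sup>2)"
  define \<phi> where "\<phi> n = char (distr M borel W) (t / sqrt (real n))" for n :: nat
  define b where "b n = exp (- (t\<^sup>2 * v / 2) / real n)" for n :: nat
  have v0: "v \<ge> 0" unfolding v_def by simp
  have intW: "integrable M W"
    by (rule square_integrable_imp_integrable[OF _ sq]) simp
  \<comment> \<open>The minimum in the Taylor error is what makes second moments enough: its first
    entry is an integrable majorant, and its second tends to 0 pointwise.\<close>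
  let ?I = "\<lambda>n. expectation (\<lambda>x. min (6 * (W x)\<^sup>2) (\<bar>t / sqrt (real n)\<bar> * \<bar>W x\<bar> ^ 3))"
  have approx: "cmod (\<phi> n - (1 - (t / sqrt (real n))\<^sup>2 * v / 2)) \<le>
      ((t / sqrt (real n))\<^sup>2 / 6) * ?I n" for n
    unfolding \<phi>_def by (rule char_approx3'[OF _ intW sq mean]) (auto simp: mean v_def)
  have "(\<lambda>n. min (6 * x\<^sup>2) (\<bar>t\<bar> * \<bar>x\<bar> ^ 3 / \<bar>sqrt (real n)\<bar>)) \<longlonglongrightarrow> 0" for x :: real
    by (auto simp: real_sqrt_mult min_absorb2
             intro!: tendsto_min[THEN tendsto_eq_rhs] sqrt_at_top[THEN filterlim_compose]
                     filterlim_at_top_imp_at_infinity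
                     tendsto_divide_0 filterlim_real_sequentially)
  then have "?I \<longlonglongrightarrow> expectation (\<lambda>x. 0)"
    by (intro integral_dominated_convergence [where w = "\<lambda>x. 6 * (W x)\<^sup>2"]) (auto simp: sq)
  then have lim1: "(\<lambda>n. t\<^sup>2 / 6 * ?I n) \<longlonglongrightarrow> 0"
    by (simp add: tendsto_mult_right_zero)
  define c where "c = t\<^sup>2 * v / 2"
  \<comment> \<open>The error of 1 - x against exp(-x) is at most x^2; with x = c / n and n factors
    this leaves c^2 / n.\<close>
  have lim2: "(\<lambda>n. real n * \<bar>1 - c / real n - exp (- c / real n)\<bar>) \<longlonglongrightarrow> 0"
  proof (rule tendsto_sandwich[OF _ _ tendsto_const])
    show "(\<lambda>n. c\<^sup>2 / real n) \<longlonglongrightarrow> 0" by real_asymp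
    have c0: "c \<ge> 0" unfolding c_def using v0 by simp
    show "\<forall>\<^sub>F n in sequentially. real n * \<bar>1 - c / real n - exp (- c / real n)\<bar> \<le> c\<^sup>2 / real n"
    proof (rule eventually_mono[OF eventually_gt_at_top[of "nat \<lceil>c\<rceil>"]])
      fix n :: nat assume "n > nat \<lceil>c\<rceil>"
      then have n: "real n > c" "n > 0" by linarith+
      define x where "x = c / real n"
      have x: "0 \<le> x" "x \<le> 1" unfolding x_def using n c0 by auto
      have "exp (-x) \<le> 1 / (1 + x)"
        using exp_ge_add_one_self[of x] x by (simp add: exp_minus field_simps)
      also have "\<dots> \<le> 1 - x + x\<^sup>2"
      proof -
        have "(1 - x + x\<^sup>2) * (1 + x) = 1 + x ^ 3"
          by (simp add: algebra_simps power2_eq_square power3_eq_cube)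
        also have "\<dots> \<ge> 1" using x by simp
        finally show ?thesis using x by (simp add: divide_le_eq)
      qed
      finally have "\<bar>1 - x - exp (-x)\<bar> \<le> x\<^sup>2"
        using exp_ge_add_one_self[of "-x"] by simp
      then have "real n * \<bar>1 - x - exp (-x)\<bar> \<le> real n * x\<^sup>2"
        by (intro mult_left_mono) auto
      also have "\<dots> = c\<^sup>2 / real n" using n by (simp add: x_def power2_eq_square)
      finally show "real n * \<bar>1 - c / real n - exp (- c / real n)\<bar> \<le> c\<^sup>2 / real n"
        unfolding x_def by simp
    qed
  qed auto
  have b01: "0 \<le> b n" "b n \<le> 1" for n
    using v0 by (auto simp: b_def)
  have key: "cmod (\<phi> n ^ m n - complex_of_real (b n ^ m n)) \<le>
      t\<^sup>2 / 6 * ?I n + real n * \<bar>1 - c / real n - exp (- c / real n)\<bar>" if "n > 0" for n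
  proof -
    \<comment> \<open>Telescoping: both bases have modulus at most 1, so the powers differ by at
      most \<open>m n\<close> times the difference of the bases.\<close>
    have "cmod (\<phi> n ^ m n - complex_of_real (b n) ^ m n) \<le> real (m n) * cmod (\<phi> n - complex_of_real (b n))"
      using b01[of n] by (intro norm_power_diff) (auto simp: \<phi>_def D.cmod_char_le_1)
    also have "\<dots> \<le> real n * cmod (\<phi> n - complex_of_real (b n))"
      using mn by (intro mult_right_mono) auto
    also have "cmod (\<phi> n - complex_of_real (b n)) \<le>
        cmod (\<phi> n - (1 - (t / sqrt (real n))\<^sup>2 * v / 2)) +
        cmod ((1 - (t / sqrt (real n))\<^sup>2 * v / 2) - complex_of_real (b n))"
      by (rule order.trans[OF _ norm_triangle_ineq]) (simp add: algebra_simps)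
    also have "\<dots> \<le> ((t / sqrt (real n))\<^sup>2 / 6) * ?I n + \<bar>1 - c / real n - exp (- c / real n)\<bar>"
    proof (rule add_mono[OF approx])
      have "(1 - (t / sqrt (real n))\<^sup>2 * v / 2) - complex_of_real (b n) =
         complex_of_real (1 - c / real n - exp (- c / real n))"
        unfolding of_real_diff by (simp add: b_def c_def power_divide)
      then show "cmod ((1 - (t / sqrt (real n))\<^sup>2 * v / 2) - complex_of_real (b n)) \<le>
          \<bar>1 - c / real n - exp (- c / real n)\<bar>"
        using norm_of_real[where 'a=complex] by (metis order_refl)
    qed
    also have "real n * \<dots> = t\<^sup>2 / 6 * ?I n + real n * \<bar>1 - c / real n - exp (- c / real n)\<bar>"
      using that by (simp add: distrib_left power_divide)
    finally show ?thesis using mult_left_mono[of _ _ "real n"] by simp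
  qed
  have "(\<lambda>n. t\<^sup>2 / 6 * ?I n + real n * \<bar>1 - c / real n - exp (- c / real n)\<bar>) \<longlonglongrightarrow> 0"
    using tendsto_add[OF lim1 lim2] by simp
  then have "(\<lambda>n. \<phi> n ^ m n - complex_of_real (b n ^ m n)) \<longlonglongrightarrow> 0"
    by (rule Lim_null_comparison[rotated])
       (use key in \<open>auto intro!: eventually_mono[OF eventually_gt_at_top[of 0]]\<close>)
  moreover have "(\<lambda>n. complex_of_real (b n ^ m n)) \<longlonglongrightarrow> complex_of_real (exp (- (t\<^sup>2 * (\<rho> * v) / 2)))"
  proof (rule tendsto_of_real)
    have "(\<lambda>n. exp (- (t\<^sup>2 * v / 2) * (real (m n) / real n))) \<longlonglongrightarrow> exp (- (t\<^sup>2 * v / 2) * \<rho>)"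
      by (intro tendsto_intros m)
    moreover have "exp (- (t\<^sup>2 * v / 2) * (real (m n) / real n)) = b n ^ m n" for n
      unfolding b_def exp_of_nat_mult[symmetric] by (simp add: field_simps)
    moreover have "exp (- (t\<^sup>2 * v / 2) * \<rho>) = exp (- (t\<^sup>2 * (\<rho> * v) / 2))"
      by (simp add: mult_ac)
    ultimately show "(\<lambda>n. b n ^ m n) \<longlonglongrightarrow> exp (- (t\<^sup>2 * (\<rho> * v) / 2))" by (simp only:)
  qed
  ultimately show ?thesis
    unfolding \<phi>_def v_def by (rule Lim_transform[rotated])
qed

text \<open>The affine form of \<open>normal_law\<close> lets the degenerate case V = 0 be treated
  together with V > 0.\<close>

lemma char_normal_law:
  assumes "V \<ge> 0"
  shows "char (normal_law 0 V) t = complex_of_real (exp (- (t\<^sup>2 * V / 2)))"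
proof -
  have "char (normal_law 0 V) t = char std_normal_distribution (t * sqrt V)"
    unfolding normal_law_def char_def by (subst integral_distr) (auto simp: mult_ac)
  then show ?thesis
    using assms by (simp add: char_std_normal_distribution power_mult_distrib)
qed

lemma real_distribution_normal_law: "real_distribution (normal_law \<mu> v)"
proof -
  interpret N: real_distribution std_normal_distribution
    by (rule real_dist_normal_dist)
  show ?thesis unfolding normal_law_def by (rule N.real_distribution_distr) simp
qed

text \<open>Slutsky's theorem for characteristic functions: the integrands differ by at most |t|
  \<epsilon> where F and G are \<epsilon>-close, and by at most 2 on the remaining event.\<close>

lemma (in prob_space) char_tendsto_conv_in_prob:
  fixes F G :: "nat \<Rightarrow> 'a \<Rightarrow> real"
  assumes [measurable]: "\<And>n. random_variable borel (F n)" "\<And>n. random_variable borel (G n)"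
    and conv: "conv_in_prob_zero M (\<lambda>n \<omega>. G n \<omega> - F n \<omega>)"
    and lim: "(\<lambda>n. char (distr M borel (F n)) t) \<longlonglongrightarrow> L"
  shows "(\<lambda>n. char (distr M borel (G n)) t) \<longlonglongrightarrow> L"
proof -
  have bound: "cmod (char (distr M borel (G n)) t - char (distr M borel (F n)) t) \<le>
      \<bar>t\<bar> * \<epsilon> + 2 * measure M {\<omega> \<in> space M. norm (G n \<omega> - F n \<omega>) > \<epsilon>}" if "\<epsilon> > 0" for n \<epsilon>
  proof -
    let ?B = "{\<omega> \<in> space M. norm (G n \<omega> - F n \<omega>) > \<epsilon>}"
    have [measurable]: "?B \<in> sets M" by measurable
    have int: "integrable M (\<lambda>\<omega>. iexp (t * G n \<omega>))" "integrable M (\<lambda>\<omega>. iexp (t * F n \<omega>))"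
      by (auto intro!: integrable_const_bound[where B=1])
    have "char (distr M borel (G n)) t - char (distr M borel (F n)) t =
        (CLINT \<omega>|M. iexp (t * G n \<omega>) - iexp (t * F n \<omega>))"
      unfolding char_def Bochner_Integration.integral_diff[OF int]
      by (simp add: integral_distr)
    also have "cmod \<dots> \<le> expectation (\<lambda>\<omega>. \<bar>t\<bar> * \<epsilon> + 2 * indicator ?B \<omega>)"
    proof (rule order.trans[OF integral_norm_bound integral_mono])
      fix \<omega> assume "\<omega> \<in> space M"
      show "cmod (iexp (t * G n \<omega>) - iexp (t * F n \<omega>)) \<le> \<bar>t\<bar> * \<epsilon> + 2 * indicator ?B \<omega>"
      proof (cases "\<omega> \<in> ?B")
        case True
        have "cmod (iexp (t * G n \<omega>) - iexp (t * F n \<omega>)) \<le> 1 + 1"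
          by (rule order.trans[OF norm_triangle_ineq4]) simp
        then show ?thesis using True that by (simp add: add_increasing)
      next
        case False
        have "iexp (t * G n \<omega>) - iexp (t * F n \<omega>) =
            iexp (t * F n \<omega>) * (iexp (t * (G n \<omega> - F n \<omega>)) - 1)"
          by (simp add: right_diff_distrib exp_add[symmetric] algebra_simps)
        then have "cmod (iexp (t * G n \<omega>) - iexp (t * F n \<omega>)) =
            cmod (iexp (t * (G n \<omega> - F n \<omega>)) - 1)"
          by (simp add: norm_mult)
        also have "\<dots> \<le> \<bar>t * (G n \<omega> - F n \<omega>)\<bar>"
          using iexp_approx1[of "t * (G n \<omega> - F n \<omega>)" 0] by simp
        also have "\<dots> \<le> \<bar>t\<bar> * \<epsilon>"
          using False \<open>\<omega> \<in> space M\<close> by (auto simp: abs_mult intro!: mult_left_mono)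
        finally show ?thesis using False by simp
      qed
    qed (use int in \<open>auto intro!: integrable_norm Bochner_Integration.integrable_diff simp: less_top[symmetric]\<close>)
    also have "\<dots> = \<bar>t\<bar> * \<epsilon> + 2 * measure M ?B"
      by (subst Bochner_Integration.integral_add)
         (auto simp: prob_space less_top[symmetric])
    finally show ?thesis .
  qed
  have "(\<lambda>n. char (distr M borel (G n)) t - char (distr M borel (F n)) t) \<longlonglongrightarrow> 0"
  proof (rule tendstoI)
    fix e :: real assume "e > 0"
    \<comment> \<open>The summand 1 covers t = 0. This choice spends less than e / 2 on the close
      part; the exceptional event counts twice, so its probability is brought below e / 4.\<close>
    define \<epsilon> where "\<epsilon> = e / (2 * (\<bar>t\<bar> + 1))"
    have \<epsilon>: "\<epsilon> > 0" "\<bar>t\<bar> * \<epsilon> < e / 2"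
      unfolding \<epsilon>_def using \<open>e > 0\<close> by (auto simp: field_simps)
    have "\<forall>\<^sub>F n in sequentially. measure M {\<omega> \<in> space M. norm (G n \<omega> - F n \<omega>) > \<epsilon>} < e / 4"
      using conv \<epsilon> \<open>e > 0\<close> unfolding conv_in_prob_zero_def
      by (intro order_tendstoD(2)[where a="e/4"]) auto
    then show "\<forall>\<^sub>F n in sequentially.
      dist (char (distr M borel (G n)) t - char (distr M borel (F n)) t) 0 < e"
    proof eventually_elim
      case (elim n)
      show ?case using bound[OF \<epsilon>(1), of n] elim \<epsilon> unfolding dist_0_norm norm_conv_dist[symmetric] by simp
    qed
  qed
  then show ?thesis using tendsto_add[OF _ lim] by fastforce
qed

section \<open>Convergence and boundedness in probability\<close>

text \<open>This is O_P(1). The bound is asked only eventually, which fits quantities such as sqrt n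
  / sqrt r that are controlled only for large n.\<close>

definition bounded_in_prob :: "'a measure \<Rightarrow> (nat \<Rightarrow> 'a \<Rightarrow> 'b::real_normed_vector) \<Rightarrow> bool" where
  "bounded_in_prob M Z \<longleftrightarrow>
     (\<forall>\<epsilon>>0. \<exists>K>0. \<forall>\<^sub>F n in sequentially. measure M {\<omega> \<in> space M. norm (Z n \<omega>) > K} < \<epsilon>)"

context prob_space
begin

lemma conv_in_prob_zero_iff:
  "conv_in_prob_zero M Z \<longleftrightarrow>
     (\<forall>\<epsilon>>0. \<forall>e>0. \<forall>\<^sub>F n in sequentially. measure M {\<omega> \<in> space M. norm (Z n \<omega>) > \<epsilon>} < e)"
  unfolding conv_in_prob_zero_def tendsto_iff by simp

lemma conv_in_prob_zero_imp_bounded: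
  "conv_in_prob_zero M Z \<Longrightarrow> bounded_in_prob M Z"
  unfolding conv_in_prob_zero_iff bounded_in_prob_def
  by (meson zero_less_one)

lemma conv_in_prob_zero_add:
  fixes Y Z :: "nat \<Rightarrow> 'a \<Rightarrow> 'b::euclidean_space"
  assumes [measurable]: "\<And>n. random_variable borel (Y n)" "\<And>n. random_variable borel (Z n)"
    and Y: "conv_in_prob_zero M Y" and Z: "conv_in_prob_zero M Z"
  shows "conv_in_prob_zero M (\<lambda>n \<omega>. Y n \<omega> + Z n \<omega>)"
  unfolding conv_in_prob_zero_iff
proof (intro allI impI)
  fix \<epsilon> e :: real assume "\<epsilon> > 0" "e > 0"
  have "\<forall>\<^sub>F n in sequentially. measure M {\<omega> \<in> space M. norm (Y n \<omega>) > \<epsilon>/2} < e/2"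
    "\<forall>\<^sub>F n in sequentially. measure M {\<omega> \<in> space M. norm (Z n \<omega>) > \<epsilon>/2} < e/2"
    using Y Z \<open>\<epsilon> > 0\<close> \<open>e > 0\<close> unfolding conv_in_prob_zero_iff by (meson half_gt_zero)+
  then show "\<forall>\<^sub>F n in sequentially. measure M {\<omega> \<in> space M. norm (Y n \<omega> + Z n \<omega>) > \<epsilon>} < e"
  proof eventually_elim
    case (elim n)
    have "measure M {\<omega> \<in> space M. norm (Y n \<omega> + Z n \<omega>) > \<epsilon>} \<le>
      measure M ({\<omega> \<in> space M. norm (Y n \<omega>) > \<epsilon>/2} \<union> {\<omega> \<in> space M. norm (Z n \<omega>) > \<epsilon>/2})"
    proof (rule finite_measure_mono)
      show "{\<omega> \<in> space M. norm (Y n \<omega> + Z n \<omega>) > \<epsilon>} \<subseteq>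
        {\<omega> \<in> space M. norm (Y n \<omega>) > \<epsilon>/2} \<union> {\<omega> \<in> space M. norm (Z n \<omega>) > \<epsilon>/2}"
      proof
        fix \<omega> assume "\<omega> \<in> {\<omega> \<in> space M. norm (Y n \<omega> + Z n \<omega>) > \<epsilon>}"
        then show "\<omega> \<in> {\<omega> \<in> space M. norm (Y n \<omega>) > \<epsilon>/2} \<union> {\<omega> \<in> space M. norm (Z n \<omega>) > \<epsilon>/2}"
          using norm_triangle_ineq[of "Y n \<omega>" "Z n \<omega>"] by auto
      qed
    qed measurable
    also have "\<dots> \<le> measure M {\<omega> \<in> space M. norm (Y n \<omega>) > \<epsilon>/2} +
        measure M {\<omega> \<in> space M. norm (Z n \<omega>) > \<epsilon>/2}"
      by (rule measure_Un_le) measurable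
    finally show ?case using elim by simp
  qed
qed

lemma bounded_in_prob_add:
  fixes Y Z :: "nat \<Rightarrow> 'a \<Rightarrow> 'b::euclidean_space"
  assumes [measurable]: "\<And>n. random_variable borel (Y n)" "\<And>n. random_variable borel (Z n)"
    and Y: "bounded_in_prob M Y" and Z: "bounded_in_prob M Z"
  shows "bounded_in_prob M (\<lambda>n \<omega>. Y n \<omega> + Z n \<omega>)"
  unfolding bounded_in_prob_def
proof (intro allI impI)
  fix e :: real assume "e > 0"
  obtain K where K: "K > 0" "\<forall>\<^sub>F n in sequentially. measure M {\<omega> \<in> space M. norm (Y n \<omega>) > K} < e/2"
    using Y \<open>e > 0\<close> unfolding bounded_in_prob_def by (meson half_gt_zero)
  obtain L where L: "L > 0" "\<forall>\<^sub>F n in sequentially. measure M {\<omega> \<in> space M. norm (Z n \<omega>) > L} < e/2"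
    using Z \<open>e > 0\<close> unfolding bounded_in_prob_def by (meson half_gt_zero)
  have "\<forall>\<^sub>F n in sequentially. measure M {\<omega> \<in> space M. norm (Y n \<omega> + Z n \<omega>) > K + L} < e"
    using K(2) L(2)
  proof eventually_elim
    case (elim n)
    have "measure M {\<omega> \<in> space M. norm (Y n \<omega> + Z n \<omega>) > K + L} \<le>
      measure M ({\<omega> \<in> space M. norm (Y n \<omega>) > K} \<union> {\<omega> \<in> space M. norm (Z n \<omega>) > L})"
    proof (rule finite_measure_mono)
      show "{\<omega> \<in> space M. norm (Y n \<omega> + Z n \<omega>) > K + L} \<subseteq>
        {\<omega> \<in> space M. norm (Y n \<omega>) > K} \<union> {\<omega> \<in> space M. norm (Z n \<omega>) > L}"
      proof
        fix \<omega> assume "\<omega> \<in> {\<omega> \<in> space M. norm (Y n \<omega> + Z n \<omega>) > K + L}"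
        then show "\<omega> \<in> {\<omega> \<in> space M. norm (Y n \<omega>) > K} \<union> {\<omega> \<in> space M. norm (Z n \<omega>) > L}"
          using norm_triangle_ineq[of "Y n \<omega>" "Z n \<omega>"] by auto
      qed
    qed measurable
    also have "\<dots> \<le> measure M {\<omega> \<in> space M. norm (Y n \<omega>) > K} +
        measure M {\<omega> \<in> space M. norm (Z n \<omega>) > L}"
      by (rule measure_Un_le) measurable
    finally show ?case using elim by simp
  qed
  then show "\<exists>K>0. \<forall>\<^sub>F n in sequentially. measure M {\<omega> \<in> space M. norm (Y n \<omega> + Z n \<omega>) > K} < e"
    using K(1) L(1) by (intro exI[of _ "K + L"]) auto
qed

text \<open>The rule o_P(1) O_P(1) = o_P(1), stated for anything dominated in norm by the product.
  In this form it serves scalings and inner products alike and, with a constant second factor, plain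
  domination for large n.\<close>

lemma conv_in_prob_zero_mult_bounded:
  fixes Y :: "nat \<Rightarrow> 'a \<Rightarrow> 'b::euclidean_space" and Z :: "nat \<Rightarrow> 'a \<Rightarrow> 'c::euclidean_space"
    and W :: "nat \<Rightarrow> 'a \<Rightarrow> 'd::real_normed_vector"
  assumes [measurable]: "\<And>n. random_variable borel (Y n)" "\<And>n. random_variable borel (Z n)"
    and Y: "conv_in_prob_zero M Y" and Z: "bounded_in_prob M Z"
    and W: "\<forall>\<^sub>F n in sequentially. \<forall>\<omega>\<in>space M. norm (W n \<omega>) \<le> norm (Y n \<omega>) * norm (Z n \<omega>)"
  shows "conv_in_prob_zero M W"
  unfolding conv_in_prob_zero_iff
proof (intro allI impI)
  fix \<epsilon> e :: real assume "\<epsilon> > 0" "e > 0"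
  obtain K where K: "K > 0" "\<forall>\<^sub>F n in sequentially. measure M {\<omega> \<in> space M. norm (Z n \<omega>) > K} < e/2"
    using Z \<open>e > 0\<close> unfolding bounded_in_prob_def by (meson half_gt_zero)
  have "\<forall>\<^sub>F n in sequentially. measure M {\<omega> \<in> space M. norm (Y n \<omega>) > \<epsilon>/K} < e/2"
    using Y \<open>\<epsilon> > 0\<close> \<open>e > 0\<close> K(1) unfolding conv_in_prob_zero_iff
    by (meson half_gt_zero divide_pos_pos)
  then show "\<forall>\<^sub>F n in sequentially. measure M {\<omega> \<in> space M. norm (W n \<omega>) > \<epsilon>} < e"
    using K(2) W
  proof eventually_elim
    case (elim n)
    have "measure M {\<omega> \<in> space M. norm (W n \<omega>) > \<epsilon>} \<le>
      measure M ({\<omega> \<in> space M. norm (Y n \<omega>) > \<epsilon>/K} \<union> {\<omega> \<in> space M. norm (Z n \<omega>) > K})"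
    proof (rule finite_measure_mono)
      show "{\<omega> \<in> space M. norm (W n \<omega>) > \<epsilon>} \<subseteq>
        {\<omega> \<in> space M. norm (Y n \<omega>) > \<epsilon>/K} \<union> {\<omega> \<in> space M. norm (Z n \<omega>) > K}"
      proof (rule subsetI, rule ccontr)
        fix \<omega> assume \<omega>: "\<omega> \<in> {\<omega> \<in> space M. norm (W n \<omega>) > \<epsilon>}"
          and "\<omega> \<notin> {\<omega> \<in> space M. norm (Y n \<omega>) > \<epsilon>/K} \<union> {\<omega> \<in> space M. norm (Z n \<omega>) > K}"
        then have "norm (Y n \<omega>) \<le> \<epsilon>/K" "norm (Z n \<omega>) \<le> K" by auto
        then have "norm (Y n \<omega>) * norm (Z n \<omega>) \<le> \<epsilon>/K * K"
          using K(1) \<open>\<epsilon> > 0\<close> by (intro mult_mono) auto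
        moreover have "norm (W n \<omega>) \<le> norm (Y n \<omega>) * norm (Z n \<omega>)"
          using elim \<omega> by auto
        ultimately show False using \<omega> K(1) by auto
      qed
    qed measurable
    also have "\<dots> \<le> measure M {\<omega> \<in> space M. norm (Y n \<omega>) > \<epsilon>/K} +
        measure M {\<omega> \<in> space M. norm (Z n \<omega>) > K}"
      by (rule measure_Un_le) measurable
    finally show ?case using elim by simp
  qed
qed

lemma conv_in_prob_zero_const:
  assumes "c \<longlonglongrightarrow> 0"
  shows "conv_in_prob_zero M (\<lambda>n \<omega>. c n)"
  unfolding conv_in_prob_zero_iff
proof (intro allI impI)
  fix \<epsilon> e :: real assume "\<epsilon> > 0" "e > 0"
  have "\<forall>\<^sub>F n in sequentially. dist (c n) 0 < \<epsilon>"
    using assms \<open>\<epsilon> > 0\<close> by (rule tendstoD)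
  then show "\<forall>\<^sub>F n in sequentially. measure M {\<omega> \<in> space M. norm (c n) > \<epsilon>} < e"
    by eventually_elim (use \<open>e > 0\<close> in auto)
qed

lemma bounded_in_prob_const:
  fixes c :: "nat \<Rightarrow> 'b::real_normed_vector"
  assumes "c \<longlonglongrightarrow> l"
  shows "bounded_in_prob M (\<lambda>n \<omega>. c n)"
  unfolding bounded_in_prob_def
proof (intro allI impI)
  fix e :: real assume "e > 0"
  have "\<forall>\<^sub>F n in sequentially. norm (c n) < norm l + 1"
    using tendsto_norm[OF assms] by (rule order_tendstoD) simp
  then have "\<forall>\<^sub>F n in sequentially. measure M {\<omega> \<in> space M. norm (c n) > norm l + 1} < e"
    by eventually_elim (use \<open>e > 0\<close> in auto)
  then show "\<exists>K>0. \<forall>\<^sub>F n in sequentially. measure M {\<omega> \<in> space M. norm (c n) > K} < e"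
    by (intro exI[of _ "norm l + 1"]) (auto simp: add_nonneg_pos)
qed

lemma bounded_in_prob_le:
  fixes Z :: "nat \<Rightarrow> 'a \<Rightarrow> 'b::euclidean_space" and W :: "nat \<Rightarrow> 'a \<Rightarrow> 'c::real_normed_vector"
  assumes [measurable]: "\<And>n. random_variable borel (Z n)"
    and Z: "bounded_in_prob M Z" and "C > 0"
    and W: "\<forall>\<^sub>F n in sequentially. \<forall>\<omega>\<in>space M. norm (W n \<omega>) \<le> C * norm (Z n \<omega>)"
  shows "bounded_in_prob M W"
  unfolding bounded_in_prob_def
proof (intro allI impI)
  fix e :: real assume "e > 0"
  obtain K where K: "K > 0" "\<forall>\<^sub>F n in sequentially. measure M {\<omega> \<in> space M. norm (Z n \<omega>) > K} < e"
    using Z \<open>e > 0\<close> unfolding bounded_in_prob_def by blast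
  have "\<forall>\<^sub>F n in sequentially. measure M {\<omega> \<in> space M. norm (W n \<omega>) > C * K} < e"
    using K(2) W
  proof eventually_elim
    case (elim n)
    have "norm (Z n \<omega>) > K" if "\<omega> \<in> space M" "norm (W n \<omega>) > C * K" for \<omega>
      using bspec[OF elim(2) that(1)] that(2) \<open>C > 0\<close>
      by (metis less_le_trans mult_less_cancel_left_pos)
    then have "measure M {\<omega> \<in> space M. norm (W n \<omega>) > C * K} \<le> measure M {\<omega> \<in> space M. norm (Z n \<omega>) > K}"
      by (intro finite_measure_mono) auto
    then show ?case using elim by simp
  qed
  then show "\<exists>K>0. \<forall>\<^sub>F n in sequentially. measure M {\<omega> \<in> space M. norm (W n \<omega>) > K} < e"
    using K(1) \<open>C > 0\<close> by (intro exI[of _ "C * K"]) auto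
qed

lemma prob_norm_gt_le:
  fixes Z :: "'a \<Rightarrow> 'b::euclidean_space"
  assumes [measurable]: "random_variable borel Z"
    and int: "integrable M (\<lambda>\<omega>. (norm (Z \<omega>))\<^sup>2)" and "K > 0"
  shows "measure M {\<omega> \<in> space M. norm (Z \<omega>) > K} \<le> expectation (\<lambda>\<omega>. (norm (Z \<omega>))\<^sup>2) / K\<^sup>2"
proof -
  have "measure M {\<omega> \<in> space M. norm (Z \<omega>) > K} \<le> measure M {\<omega> \<in> space M. (norm (Z \<omega>))\<^sup>2 \<ge> K\<^sup>2}"
    using \<open>K > 0\<close> by (intro finite_measure_mono) (auto intro!: power_mono)
  also have "\<dots> \<le> expectation (\<lambda>\<omega>. (norm (Z \<omega>))\<^sup>2) / K\<^sup>2"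
    using int \<open>K > 0\<close> by (intro integral_Markov_inequality_measure[where A="{}"]) auto
  finally show ?thesis .
qed

lemma bounded_in_prob_L2:
  fixes Z :: "nat \<Rightarrow> 'a \<Rightarrow> 'b::euclidean_space"
  assumes "\<And>n. random_variable borel (Z n)" "\<And>n. integrable M (\<lambda>\<omega>. (norm (Z n \<omega>))\<^sup>2)"
    and C: "\<And>n. expectation (\<lambda>\<omega>. (norm (Z n \<omega>))\<^sup>2) \<le> C"
  shows "bounded_in_prob M Z"
  unfolding bounded_in_prob_def
proof (intro allI impI)
  fix e :: real assume "e > 0"
  have "C \<ge> 0" using C[of 0] by (rule order.trans[rotated]) simp
  \<comment> \<open>Chebyshev then gives C e / (C + 1), which is strictly below e; adding 1 also
    keeps K positive when C = 0.\<close>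
  define K where "K = sqrt ((C + 1) / e)"
  have K: "K > 0" "K\<^sup>2 = (C + 1) / e" using \<open>e > 0\<close> \<open>C \<ge> 0\<close> by (auto simp: K_def)
  have "measure M {\<omega> \<in> space M. norm (Z n \<omega>) > K} < e" for n
  proof -
    have "measure M {\<omega> \<in> space M. norm (Z n \<omega>) > K} \<le> expectation (\<lambda>\<omega>. (norm (Z n \<omega>))\<^sup>2) / K\<^sup>2"
      by (rule prob_norm_gt_le) (use assms K in auto)
    also have "\<dots> \<le> C / K\<^sup>2" using C by (rule divide_right_mono) simp
    also have "\<dots> < e" unfolding K using \<open>e > 0\<close> \<open>C \<ge> 0\<close> by (simp add: field_simps)
    finally show ?thesis .
  qed
  then show "\<exists>K>0. \<forall>\<^sub>F n in sequentially. measure M {\<omega> \<in> space M. norm (Z n \<omega>) > K} < e"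
    using K(1) by auto
qed

end

section \<open>Independent identically distributed sequences\<close>

lemma norm_square_Basis: "(norm x)\<^sup>2 = (\<Sum>b\<in>Basis. (b \<bullet> x)\<^sup>2)" for x :: "'c::euclidean_space"
  unfolding power2_norm_eq_inner by (subst euclidean_inner) (simp add: power2_eq_square inner_commute)

text \<open>Index 0 is the generic copy: moments are always stated for \<open>W 0\<close>, while
  sums run over indices from 1.\<close>

locale iid_sequence = prob_space M for M :: "'a measure" +
  fixes S :: "'b measure" and W :: "nat \<Rightarrow> 'a \<Rightarrow> 'b"
  assumes indep: "indep_vars (\<lambda>_. S) W UNIV"
    and ident: "\<And>i. distr M S (W i) = distr M S (W 0)"
begin

lemma W_measurable [measurable]: "random_variable S (W i)"
  using indep by (auto simp: indep_vars_def)

lemma distr_compose_eq: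
  assumes [measurable]: "F \<in> measurable S N"
  shows "distr M N (\<lambda>\<omega>. F (W i \<omega>)) = distr M N (\<lambda>\<omega>. F (W 0 \<omega>))"
proof -
  have "distr M N (\<lambda>\<omega>. F (W j \<omega>)) = distr (distr M S (W j)) N F" for j
    by (simp add: distr_distr comp_def)
  then show ?thesis by (simp add: ident[of i])
qed

lemma nn_integral_compose_eq:
  assumes [measurable]: "F \<in> borel_measurable S"
  shows "(\<integral>\<^sup>+\<omega>. F (W i \<omega>) \<partial>M) = (\<integral>\<^sup>+\<omega>. F (W 0 \<omega>) \<partial>M)"
proof -
  have "(\<integral>\<^sup>+\<omega>. F (W j \<omega>) \<partial>M) = (\<integral>\<^sup>+x. F x \<partial>distr M S (W j))" for j
    by (simp add: nn_integral_distr)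
  then show ?thesis by (simp add: ident[of i])
qed

lemma integrable_compose_iff:
  fixes F :: "'b \<Rightarrow> 'c::{banach, second_countable_topology}"
  assumes [measurable]: "F \<in> borel_measurable S"
  shows "integrable M (\<lambda>\<omega>. F (W i \<omega>)) \<longleftrightarrow> integrable M (\<lambda>\<omega>. F (W 0 \<omega>))"
proof -
  have "integrable M (\<lambda>\<omega>. F (W j \<omega>)) \<longleftrightarrow> integrable (distr M S (W j)) F" for j
    by (simp add: integrable_distr_eq)
  then show ?thesis by (simp add: ident[of i])
qed

lemma expectation_compose_eq:
  fixes F :: "'b \<Rightarrow> 'c::{banach, second_countable_topology}"
  assumes [measurable]: "F \<in> borel_measurable S"
  shows "expectation (\<lambda>\<omega>. F (W i \<omega>)) = expectation (\<lambda>\<omega>. F (W 0 \<omega>))"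
proof -
  have "expectation (\<lambda>\<omega>. F (W j \<omega>)) = (\<integral>x. F x \<partial>distr M S (W j))" for j
    by (simp add: integral_distr)
  then show ?thesis by (simp add: ident[of i])
qed

text \<open>The squared norm is the sum of the squared coordinates, and each coordinate of the sum
  is a scalar sum of centred independent terms.\<close>

lemma expectation_norm_square_sum:
  fixes F :: "'b \<Rightarrow> 'c::euclidean_space"
  assumes [measurable]: "F \<in> borel_measurable S"
    and sq: "integrable M (\<lambda>\<omega>. (norm (F (W 0 \<omega>)))\<^sup>2)"
    and mean: "expectation (\<lambda>\<omega>. F (W 0 \<omega>)) = 0"
  shows "integrable M (\<lambda>\<omega>. (norm (\<Sum>i=1..m. F (W i \<omega>)))\<^sup>2)"
    and "expectation (\<lambda>\<omega>. (norm (\<Sum>i=1..m. F (W i \<omega>)))\<^sup>2) =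
      real m * expectation (\<lambda>\<omega>. (norm (F (W 0 \<omega>)))\<^sup>2)"
proof -
  have norm_sq: "(norm x)\<^sup>2 = (\<Sum>b\<in>Basis. (x \<bullet> b)\<^sup>2)" for x :: 'c
    by (simp add: norm_square_Basis inner_commute)
  have int: "integrable M (\<lambda>\<omega>. F (W 0 \<omega>))"
    using square_integrable_imp_integrable[OF _ sq] by (simp add: integrable_norm_iff)
  have sqb: "integrable M (\<lambda>\<omega>. (F (W 0 \<omega>) \<bullet> b)\<^sup>2)" if "b \<in> Basis" for b
  proof (rule Bochner_Integration.integrable_bound[OF sq])
    have "(x \<bullet> b)\<^sup>2 \<le> (norm x)\<^sup>2" for x :: 'c
      using Basis_le_norm[OF that, of x] by (simp add: abs_le_square_iff[symmetric])
    then show "AE \<omega> in M. norm ((F (W 0 \<omega>) \<bullet> b)\<^sup>2) \<le> norm ((norm (F (W 0 \<omega>)))\<^sup>2)" by simp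
  qed simp
  have meanb: "expectation (\<lambda>\<omega>. F (W 0 \<omega>) \<bullet> b) = 0" for b
    using mean int by simp
  have *: "integrable M (\<lambda>\<omega>. (\<Sum>i=1..m. F (W i \<omega>) \<bullet> b)\<^sup>2) \<and>
      expectation (\<lambda>\<omega>. (\<Sum>i=1..m. F (W i \<omega>) \<bullet> b)\<^sup>2) =
      real m * expectation (\<lambda>\<omega>. (F (W 0 \<omega>) \<bullet> b)\<^sup>2)" if "b \<in> Basis" for b
  proof -
    have ind: "indep_vars (\<lambda>_. borel) (\<lambda>i \<omega>. F (W i \<omega>) \<bullet> b) {1..m}"
      by (rule indep_vars_subset[OF indep_vars_compose2[OF indep]]) auto
    have i: "integrable M (\<lambda>\<omega>. (F (W i \<omega>) \<bullet> b)\<^sup>2)" for i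
      using sqb[OF that] integrable_compose_iff[of "\<lambda>x. (F x \<bullet> b)\<^sup>2" i] by simp
    have e: "expectation (\<lambda>\<omega>. F (W i \<omega>) \<bullet> b) = 0" for i
      using meanb[of b] expectation_compose_eq[of "\<lambda>x. F x \<bullet> b" i] by simp
    have e2: "expectation (\<lambda>\<omega>. (F (W i \<omega>) \<bullet> b)\<^sup>2) = expectation (\<lambda>\<omega>. (F (W 0 \<omega>) \<bullet> b)\<^sup>2)" for i
      using expectation_compose_eq[of "\<lambda>x. (F x \<bullet> b)\<^sup>2" i] by simp
    have "(\<Sum>i=1..m. expectation (\<lambda>\<omega>. (F (W i \<omega>) \<bullet> b)\<^sup>2)) =
        (\<Sum>i=1..m. expectation (\<lambda>\<omega>. (F (W 0 \<omega>) \<bullet> b)\<^sup>2))"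
      by (rule sum.cong[OF refl e2])
    then show ?thesis
      using expectation_square_sum_indep[where Z = "\<lambda>i \<omega>. F (W i \<omega>) \<bullet> b", OF _ ind] i e
      by simp
  qed
  show "integrable M (\<lambda>\<omega>. (norm (\<Sum>i=1..m. F (W i \<omega>)))\<^sup>2)"
    unfolding norm_sq inner_sum_left by (rule Bochner_Integration.integrable_sum) (use * in blast)
  have "expectation (\<lambda>\<omega>. (norm (\<Sum>i=1..m. F (W i \<omega>)))\<^sup>2) =
      (\<Sum>b\<in>Basis. expectation (\<lambda>\<omega>. (\<Sum>i=1..m. F (W i \<omega>) \<bullet> b)\<^sup>2))"
    unfolding norm_sq inner_sum_left by (rule Bochner_Integration.integral_sum) (use * in blast)
  also have "\<dots> = (\<Sum>b\<in>Basis. real m * expectation (\<lambda>\<omega>. (F (W 0 \<omega>) \<bullet> b)\<^sup>2))"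
    by (rule sum.cong[OF refl]) (use * in blast)
  also have "\<dots> = real m * expectation (\<lambda>\<omega>. (norm (F (W 0 \<omega>)))\<^sup>2)"
    unfolding norm_sq sum_distrib_left[symmetric]
    by (subst Bochner_Integration.integral_sum) (use sqb in auto)
  finally show "expectation (\<lambda>\<omega>. (norm (\<Sum>i=1..m. F (W i \<omega>)))\<^sup>2) =
      real m * expectation (\<lambda>\<omega>. (norm (F (W 0 \<omega>)))\<^sup>2)" .
qed

text \<open>The number of terms \<open>m n\<close> and the scale \<open>k n\<close> are kept apart
  because the sum over labeled data is normed once by sqrt r and once by sqrt n. If
  \<open>k n = 0\<close>, the prefactor is 0 by convention and the bound persists.\<close>

lemma bounded_in_prob_sum:
  fixes F :: "'b \<Rightarrow> 'c::euclidean_space"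
  assumes [measurable]: "F \<in> borel_measurable S"
    and sq: "integrable M (\<lambda>\<omega>. (norm (F (W 0 \<omega>)))\<^sup>2)"
    and mean: "expectation (\<lambda>\<omega>. F (W 0 \<omega>)) = 0"
    and le: "\<And>n. m n \<le> k n"
  shows "bounded_in_prob M (\<lambda>n \<omega>. (1 / sqrt (real (k n))) *\<^sub>R (\<Sum>i=1..m n. F (W i \<omega>)))"
proof (rule bounded_in_prob_L2)
  note * = expectation_norm_square_sum[OF assms(1-3)]
  have eq: "(norm ((1 / sqrt (real (k n))) *\<^sub>R x))\<^sup>2 = (1 / real (k n)) * (norm x)\<^sup>2" for n and x :: 'c
    by (simp add: power_mult_distrib power_divide)
  fix n
  show "integrable M (\<lambda>\<omega>. (norm ((1 / sqrt (real (k n))) *\<^sub>R (\<Sum>i=1..m n. F (W i \<omega>))))\<^sup>2)"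
    unfolding eq using *(1) by simp
  have "expectation (\<lambda>\<omega>. (norm ((1 / sqrt (real (k n))) *\<^sub>R (\<Sum>i=1..m n. F (W i \<omega>))))\<^sup>2) =
      (real (m n) / real (k n)) * expectation (\<lambda>\<omega>. (norm (F (W 0 \<omega>)))\<^sup>2)"
    unfolding eq using *(2) by simp
  also have "\<dots> \<le> 1 * expectation (\<lambda>\<omega>. (norm (F (W 0 \<omega>)))\<^sup>2)"
    using le[of n] by (intro mult_right_mono) (auto simp: divide_le_eq)
  finally show "expectation (\<lambda>\<omega>. (norm ((1 / sqrt (real (k n))) *\<^sub>R (\<Sum>i=1..m n. F (W i \<omega>))))\<^sup>2) \<le>
      expectation (\<lambda>\<omega>. (norm (F (W 0 \<omega>)))\<^sup>2)" by simp
qed simp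

text \<open>The average is 1 / sqrt n times a quantity bounded in probability.\<close>

lemma weak_law_of_large_numbers:
  fixes F :: "'b \<Rightarrow> 'c::euclidean_space"
  assumes [measurable]: "F \<in> borel_measurable S"
    and sq: "integrable M (\<lambda>\<omega>. (norm (F (W 0 \<omega>)))\<^sup>2)"
    and mean: "expectation (\<lambda>\<omega>. F (W 0 \<omega>)) = 0"
  shows "conv_in_prob_zero M (\<lambda>n \<omega>. (1 / real n) *\<^sub>R (\<Sum>i=1..n. F (W i \<omega>)))"
proof (rule conv_in_prob_zero_mult_bounded)
  show "conv_in_prob_zero M (\<lambda>n \<omega>. 1 / sqrt (real n))"
    by (rule conv_in_prob_zero_const) real_asymp
  show "bounded_in_prob M (\<lambda>n \<omega>. (1 / sqrt (real n)) *\<^sub>R (\<Sum>i=1..n. F (W i \<omega>)))"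
    by (rule bounded_in_prob_sum) (use assms in auto)
qed (auto intro!: always_eventually simp: divide_simps)

text \<open>By independence the characteristic function factors into \<open>r n\<close> equal terms
  for f and \<open>n - r n\<close> equal terms for h, both at t / sqrt n, and
  \<open>char_power_tendsto\<close> treats each power. When \<gamma> = 1 the second power is simply
  the case \<rho> = 0, with limit 1.\<close>

lemma char_two_block_sum_tendsto:
  fixes f h :: "'b \<Rightarrow> real"
  assumes [measurable]: "f \<in> borel_measurable S" "h \<in> borel_measurable S"
    and f: "integrable M (\<lambda>\<omega>. (f (W 0 \<omega>))\<^sup>2)" "expectation (\<lambda>\<omega>. f (W 0 \<omega>)) = 0"
    and h: "integrable M (\<lambda>\<omega>. (h (W 0 \<omega>))\<^sup>2)" "expectation (\<lambda>\<omega>. h (W 0 \<omega>)) = 0"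
    and r: "\<And>n. r n \<le> n" "(\<lambda>n. real (r n) / real n) \<longlonglongrightarrow> \<gamma>"
  shows "(\<lambda>n. char (distr M borel (\<lambda>\<omega>. (1 / sqrt (real n)) *
        (\<Sum>i=1..n. if i \<le> r n then f (W i \<omega>) else h (W i \<omega>)))) t) \<longlonglongrightarrow>
      complex_of_real (exp (- (t\<^sup>2 * (\<gamma> * expectation (\<lambda>\<omega>. (f (W 0 \<omega>))\<^sup>2) +
        (1 - \<gamma>) * expectation (\<lambda>\<omega>. (h (W 0 \<omega>))\<^sup>2)) / 2)))"
proof -
  let ?f = "\<lambda>n. char (distr M borel (\<lambda>\<omega>. f (W 0 \<omega>))) (t / sqrt (real n))"
  let ?h = "\<lambda>n. char (distr M borel (\<lambda>\<omega>. h (W 0 \<omega>))) (t / sqrt (real n))"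
  have eq: "char (distr M borel (\<lambda>\<omega>. (1 / sqrt (real n)) *
        (\<Sum>i=1..n. if i \<le> r n then f (W i \<omega>) else h (W i \<omega>)))) t = ?f n ^ r n * ?h n ^ (n - r n)" for n
  proof -
    let ?Z = "\<lambda>i \<omega>. if i \<le> r n then f (W i \<omega>) else h (W i \<omega>)"
    have ind: "indep_vars (\<lambda>_. borel) ?Z {1..n}"
      by (rule indep_vars_subset[OF indep_vars_compose2[OF indep,
            where Y = "\<lambda>i x. if i \<le> r n then f x else h x"]]) auto
    have "char (distr M borel (\<lambda>\<omega>. (1 / sqrt (real n)) * (\<Sum>i=1..n. ?Z i \<omega>))) t =
        char (distr M borel (\<lambda>\<omega>. \<Sum>i=1..n. ?Z i \<omega>)) (t / sqrt (real n))"
      unfolding char_def by (subst (1 2) integral_distr) (auto simp: field_simps)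
    also have "\<dots> = (\<Prod>i=1..n. char (distr M borel (?Z i)) (t / sqrt (real n)))"
      by (rule char_distr_sum[OF ind])
    also have "\<dots> = (\<Prod>i=1..n. if i \<le> r n then ?f n else ?h n)"
    proof (rule prod.cong[OF refl])
      fix i
      show "char (distr M borel (?Z i)) (t / sqrt (real n)) = (if i \<le> r n then ?f n else ?h n)"
        using distr_compose_eq[of f borel i] distr_compose_eq[of h borel i] by simp
    qed
    also have "\<dots> = (\<Prod>i\<in>{1..n} \<inter> {i. i \<le> r n}. ?f n) * (\<Prod>i\<in>{1..n} \<inter> - {i. i \<le> r n}. ?h n)"
      by (rule prod.If_cases) simp
    also have "{1..n} \<inter> {i. i \<le> r n} = {1..r n}" using r(1)[of n] by auto
    also have "{1..n} \<inter> - {i. i \<le> r n} = {r n<..n}" by auto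
    finally show ?thesis by simp
  qed
  have m2: "(\<lambda>n. real (n - r n) / real n) \<longlonglongrightarrow> 1 - \<gamma>"
  proof (rule Lim_transform_eventually)
    show "(\<lambda>n. 1 - real (r n) / real n) \<longlonglongrightarrow> 1 - \<gamma>" by (intro tendsto_intros r)
    show "\<forall>\<^sub>F n in sequentially. 1 - real (r n) / real n = real (n - r n) / real n"
      using eventually_gt_at_top[of 0]
      by eventually_elim (use r(1) in \<open>auto simp: of_nat_diff field_simps\<close>)
  qed
  have "(\<lambda>n. ?f n ^ r n * ?h n ^ (n - r n)) \<longlonglongrightarrow>
    complex_of_real (exp (- (t\<^sup>2 * (\<gamma> * expectation (\<lambda>\<omega>. (f (W 0 \<omega>))\<^sup>2)) / 2))) *
    complex_of_real (exp (- (t\<^sup>2 * ((1 - \<gamma>) * expectation (\<lambda>\<omega>. (h (W 0 \<omega>))\<^sup>2)) / 2)))"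
    by (intro tendsto_mult char_power_tendsto f h r m2) auto
  moreover have "exp (- (t\<^sup>2 * (\<gamma> * a) / 2)) * exp (- (t\<^sup>2 * ((1 - \<gamma>) * b) / 2)) =
      exp (- (t\<^sup>2 * (\<gamma> * a + (1 - \<gamma>) * b) / 2))" for a b
    unfolding exp_add[symmetric] by (rule arg_cong[where f=exp]) (simp add: field_simps)
  ultimately show ?thesis
    unfolding eq of_real_mult[symmetric] by (simp only:)
qed

end

section \<open>Conditional probabilities\<close>

context prob_space
begin

text \<open>The hypothesis \<open>cond\<close> says that two measures agree on every A: the law of X
  on the event D, and the law of X weighted by h. As an identity of measures it extends from
  indicators to unbounded functions.\<close>

lemma distr_density_cond_prob:
  assumes [measurable]: "random_variable N X" "D \<in> events" "h \<in> borel_measurable N"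
    and h: "\<And>x. 0 \<le> h x" "\<And>x. h x \<le> 1"
    and cond: "\<And>A. A \<in> sets N \<Longrightarrow>
      prob (D \<inter> (X -` A \<inter> space M)) = expectation (\<lambda>\<omega>. indicator A (X \<omega>) * h (X \<omega>))"
  shows "distr (density M (\<lambda>\<omega>. ennreal (indicator D \<omega>))) N X =
    density (distr M N X) (\<lambda>x. ennreal (h x))"
proof (rule measure_eqI)
  fix A assume "A \<in> sets (distr (density M (\<lambda>\<omega>. ennreal (indicator D \<omega>))) N X)"
  then have A [measurable]: "A \<in> sets N" by simp
  have "emeasure (distr (density M (\<lambda>\<omega>. ennreal (indicator D \<omega>))) N X) A =
      (\<integral>\<^sup>+\<omega>. ennreal (indicator D \<omega>) * indicator (X -` A \<inter> space M) \<omega> \<partial>M)"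
    by (subst emeasure_distr, simp, simp, subst emeasure_density) auto
  also have "\<dots> = (\<integral>\<^sup>+\<omega>. indicator (D \<inter> (X -` A \<inter> space M)) \<omega> \<partial>M)"
    by (rule nn_integral_cong) (auto simp: indicator_def)
  also have "\<dots> = emeasure M (D \<inter> (X -` A \<inter> space M))"
    by (rule nn_integral_indicator) measurable
  also have "\<dots> = ennreal (expectation (\<lambda>\<omega>. indicator A (X \<omega>) * h (X \<omega>)))"
    by (simp add: emeasure_eq_measure cond)
  also have "\<dots> = (\<integral>\<^sup>+\<omega>. ennreal (indicator A (X \<omega>) * h (X \<omega>)) \<partial>M)"
    by (rule nn_integral_eq_integral[symmetric])
       (auto intro!: integrable_const_bound[where B=1] AE_I2 simp: h indicator_def)
  also have "\<dots> = emeasure (density (distr M N X) (\<lambda>x. ennreal (h x))) A"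
    by (simp add: emeasure_density nn_integral_distr)
       (auto intro!: nn_integral_cong simp: indicator_def)
  finally show "emeasure (distr (density M (\<lambda>\<omega>. ennreal (indicator D \<omega>))) N X) A =
      emeasure (density (distr M N X) (\<lambda>x. ennreal (h x))) A" .
qed simp

text \<open>Both sides integrate k against the same measure. Integrability is transferred along with
  the value, since k will be a quotient such as d / h, about which nothing is known
  beforehand.\<close>

lemma cond_prob_integral:
  fixes k :: "'b \<Rightarrow> real"
  assumes [measurable]: "random_variable N X" "D \<in> events" "h \<in> borel_measurable N"
      "k \<in> borel_measurable N"
    and h: "\<And>x. 0 \<le> h x" "\<And>x. h x \<le> 1"
    and cond: "\<And>A. A \<in> sets N \<Longrightarrow>
      prob (D \<inter> (X -` A \<inter> space M)) = expectation (\<lambda>\<omega>. indicator A (X \<omega>) * h (X \<omega>))"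
  shows "integrable M (\<lambda>\<omega>. indicator D \<omega> * k (X \<omega>)) \<longleftrightarrow> integrable M (\<lambda>\<omega>. h (X \<omega>) * k (X \<omega>))"
    and "expectation (\<lambda>\<omega>. indicator D \<omega> * k (X \<omega>)) = expectation (\<lambda>\<omega>. h (X \<omega>) * k (X \<omega>))"
proof -
  have eq: "distr (density M (\<lambda>\<omega>. ennreal (indicator D \<omega>))) N X =
      density (distr M N X) (\<lambda>x. ennreal (h x))"
    by (rule distr_density_cond_prob[OF assms(1-3) h]) (rule cond)
  have "integrable M (\<lambda>\<omega>. indicator D \<omega> * k (X \<omega>)) \<longleftrightarrow>
      integrable (distr (density M (\<lambda>\<omega>. ennreal (indicator D \<omega>))) N X) k"
    by (subst integrable_distr_eq, simp, simp, subst integrable_density) auto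
  also have "\<dots> \<longleftrightarrow> integrable M (\<lambda>\<omega>. h (X \<omega>) * k (X \<omega>))"
    unfolding eq by (simp add: integrable_distr_eq integrable_density h)
  finally show "integrable M (\<lambda>\<omega>. indicator D \<omega> * k (X \<omega>)) \<longleftrightarrow> integrable M (\<lambda>\<omega>. h (X \<omega>) * k (X \<omega>))" .
  have "expectation (\<lambda>\<omega>. indicator D \<omega> * k (X \<omega>)) =
      integral\<^sup>L (distr (density M (\<lambda>\<omega>. ennreal (indicator D \<omega>))) N X) k"
    by (subst integral_distr, simp, simp, subst integral_density) auto
  also have "\<dots> = expectation (\<lambda>\<omega>. h (X \<omega>) * k (X \<omega>))"
    unfolding eq by (simp add: integral_distr integral_density h)
  finally show "expectation (\<lambda>\<omega>. indicator D \<omega> * k (X \<omega>)) = expectation (\<lambda>\<omega>. h (X \<omega>) * k (X \<omega>))" .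
qed

text \<open>Testing the conditional expectation on the events {X \<in> A}, which generate its
  sigma-algebra, turns the almost sure model equation into the integral form assumed by the lemmas
  above.\<close>

lemma real_cond_exp_cond_prob:
  assumes [measurable]: "random_variable N X" "D \<in> events" "h \<in> borel_measurable N"
    and cond: "AE \<omega> in M. real_cond_exp M (vimage_algebra (space M) X N) (indicator D) \<omega> = h (X \<omega>)"
    and A [measurable]: "A \<in> sets N"
  shows "prob (D \<inter> (X -` A \<inter> space M)) = expectation (\<lambda>\<omega>. indicator A (X \<omega>) * h (X \<omega>))"
proof -
  let ?F = "vimage_algebra (space M) X N"
  have X: "X \<in> space M \<rightarrow> space N" using measurable_space[OF assms(1)] by auto
  have sub: "subalgebra M ?F"
    unfolding subalgebra_def
    using measurable_iff_sets[of X M N] X assms(1) by (simp add: space_vimage_algebra)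
  interpret finite_measure_subalgebra M ?F
    by (unfold_locales) (fact sub)
  have set: "X -` A \<inter> space M \<in> sets ?F"
    by (rule in_vimage_algebra) fact
  have "prob (D \<inter> (X -` A \<inter> space M)) = expectation (\<lambda>\<omega>. indicator (X -` A \<inter> space M) \<omega> * indicator D \<omega>)"
    by (simp add: indicator_inter_arith[symmetric] Int_ac)
  also have "\<dots> = expectation (\<lambda>\<omega>. indicator (X -` A \<inter> space M) \<omega> * real_cond_exp M ?F (indicator D) \<omega>)"
    by (rule real_cond_exp_intg(2)[symmetric])
       (use set in \<open>auto intro!: integrable_const_bound[where B=1] borel_measurable_indicator
          simp: abs_mult indicator_le_1 mult_le_one\<close>)
  also have "\<dots> = expectation (\<lambda>\<omega>. indicator A (X \<omega>) * h (X \<omega>))"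
  proof (rule integral_cong_AE)
    show "AE \<omega> in M. indicator (X -` A \<inter> space M) \<omega> * real_cond_exp M ?F (indicator D) \<omega> =
        indicator A (X \<omega>) * h (X \<omega>)"
      using cond AE_space by eventually_elim (auto simp: indicator_def)
  qed (use set measurable_from_subalg[OF sub] in auto)
  finally show ?thesis .
qed

lemma cond_prob_compl:
  assumes [measurable]: "random_variable N X" "D \<in> events" "h \<in> borel_measurable N"
    and h: "\<And>x. 0 \<le> h x" "\<And>x. h x \<le> 1"
    and cond: "prob (D \<inter> (X -` A \<inter> space M)) = expectation (\<lambda>\<omega>. indicator A (X \<omega>) * h (X \<omega>))"
    and A [measurable]: "A \<in> sets N"
  shows "prob ((space M - D) \<inter> (X -` A \<inter> space M)) = expectation (\<lambda>\<omega>. indicator A (X \<omega>) * (1 - h (X \<omega>)))"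
proof -
  have "prob ((space M - D) \<inter> (X -` A \<inter> space M)) = prob ((X -` A \<inter> space M) - D \<inter> (X -` A \<inter> space M))"
    by (rule arg_cong[where f=prob]) auto
  also have "\<dots> = prob (X -` A \<inter> space M) - prob (D \<inter> (X -` A \<inter> space M))"
    by (rule finite_measure_Diff) auto
  also have "prob (X -` A \<inter> space M) = expectation (\<lambda>\<omega>. indicator A (X \<omega>))"
  proof -
    have "(\<lambda>\<omega>. indicator A (X \<omega>) :: real) = indicator (X -` A)" by (auto simp: indicator_def)
    then show ?thesis by simp
  qed
  also have "\<dots> - prob (D \<inter> (X -` A \<inter> space M)) =
      expectation (\<lambda>\<omega>. indicator A (X \<omega>) - indicator A (X \<omega>) * h (X \<omega>))"
    unfolding cond
    by (rule Bochner_Integration.integral_diff[symmetric])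
       (auto intro!: integrable_const_bound[where B=1] simp: indicator_def h)
  finally show ?thesis by (simp add: algebra_simps)
qed

text \<open>The residual equals d / h on D and - d / (1 - h) off D. After this split each piece is
  an indicator times a function of X, so conditioning replaces the indicator by h or by 1 - h.
  Separating the difference \<open>indicator D \<omega> - h (X \<omega>)\<close> instead would
  produce terms whose integrability is not evident.\<close>

lemma weighted_residual_moments:
  fixes d h :: "'b \<Rightarrow> real"
  assumes meas [measurable]: "random_variable N X" "D \<in> events" "h \<in> borel_measurable N"
      "d \<in> borel_measurable N"
    and h: "\<And>x. 0 < h x" "\<And>x. h x < 1"
    and cond: "\<And>A. A \<in> sets N \<Longrightarrow>
      prob (D \<inter> (X -` A \<inter> space M)) = expectation (\<lambda>\<omega>. indicator A (X \<omega>) * h (X \<omega>))"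
    and int: "integrable M (\<lambda>\<omega>. 1 / (h (X \<omega>) * (1 - h (X \<omega>))) * (d (X \<omega>))\<^sup>2)"
  defines "s \<equiv> \<lambda>\<omega>. 1 / (h (X \<omega>) * (1 - h (X \<omega>))) * (indicator D \<omega> - h (X \<omega>)) * d (X \<omega>)"
  shows "integrable M (\<lambda>\<omega>. (s \<omega>)\<^sup>2)"
    and "expectation (\<lambda>\<omega>. (s \<omega>)\<^sup>2) =
      expectation (\<lambda>\<omega>. 1 / (h (X \<omega>) * (1 - h (X \<omega>))) * (d (X \<omega>))\<^sup>2)"
    and "\<And>k C. k \<in> borel_measurable N \<Longrightarrow> (\<And>x. \<bar>k x\<bar> \<le> C) \<Longrightarrow>
      expectation (\<lambda>\<omega>. s \<omega> * k (X \<omega>)) = 0"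
proof -
  have ne: "h x \<noteq> 0" "1 - h x \<noteq> 0" "0 \<le> h x" "h x \<le> 1" "0 \<le> 1 - h x" "1 - h x \<le> 1" for x
    using h[of x] by auto
  have D1: "integrable M (\<lambda>\<omega>. indicator D \<omega> * k (X \<omega>)) \<longleftrightarrow> integrable M (\<lambda>\<omega>. h (X \<omega>) * k (X \<omega>))"
      "expectation (\<lambda>\<omega>. indicator D \<omega> * k (X \<omega>)) = expectation (\<lambda>\<omega>. h (X \<omega>) * k (X \<omega>))"
    if "k \<in> borel_measurable N" for k :: "'b \<Rightarrow> real"
    by (rule cond_prob_integral[OF meas(1,2,3) that ne(3,4)]; rule cond; assumption)+
  have D0: "integrable M (\<lambda>\<omega>. indicator (space M - D) \<omega> * k (X \<omega>)) \<longleftrightarrow>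
        integrable M (\<lambda>\<omega>. (1 - h (X \<omega>)) * k (X \<omega>))"
      "expectation (\<lambda>\<omega>. indicator (space M - D) \<omega> * k (X \<omega>)) =
        expectation (\<lambda>\<omega>. (1 - h (X \<omega>)) * k (X \<omega>))"
    if [measurable]: "k \<in> borel_measurable N" for k :: "'b \<Rightarrow> real"
    by (rule cond_prob_integral[where D = "space M - D" and h = "\<lambda>x. 1 - h x"];
        (rule cond_prob_compl[OF meas(1,2,3) ne(3,4)], rule cond)?; (simp add: ne)?)+
  let ?D = "\<lambda>\<omega>. indicator D \<omega> :: real" and ?E = "\<lambda>\<omega>. indicator (space M - D) \<omega> :: real"
  let ?w = "\<lambda>x. 1 / (h x * (1 - h x))"
  have [measurable]: "s \<in> borel_measurable M" unfolding s_def by measurable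
  \<comment> \<open>The two squared pieces, once conditioned, are the shares 1 - h and h of w d^2.
    Each is thus dominated by w d^2, and together they add up to it.\<close>
  have eq1: "h x * (d x / h x)\<^sup>2 = (1 - h x) * (?w x * (d x)\<^sup>2)" for x
    using ne[of x] by (simp add: power2_eq_square)
  have eq0: "(1 - h x) * (d x / (1 - h x))\<^sup>2 = h x * (?w x * (d x)\<^sup>2)" for x
    using ne[of x] by (simp add: power2_eq_square)
  have w0: "0 \<le> ?w x * (d x)\<^sup>2" for x using ne[of x] by simp
  have i: "integrable M (\<lambda>\<omega>. c (X \<omega>) * (?w (X \<omega>) * (d (X \<omega>))\<^sup>2))"
    if [measurable]: "c \<in> borel_measurable N" and c: "\<And>x. 0 \<le> c x" "\<And>x. c x \<le> 1" for c
  proof (rule Bochner_Integration.integrable_bound[OF int])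
    have "\<bar>c x * (?w x * (d x)\<^sup>2)\<bar> \<le> \<bar>?w x * (d x)\<^sup>2\<bar>" for x
      using c[of x] w0[of x] unfolding abs_mult[of "c x"] by (intro mult_left_le_one_le) auto
    then show "AE \<omega> in M. norm (c (X \<omega>) * (?w (X \<omega>) * (d (X \<omega>))\<^sup>2)) \<le> norm (?w (X \<omega>) * (d (X \<omega>))\<^sup>2)"
      unfolding real_norm_def by (intro AE_I2)
  qed measurable
  have i1: "integrable M (\<lambda>\<omega>. h (X \<omega>) * (d (X \<omega>) / h (X \<omega>))\<^sup>2)"
    unfolding eq1 by (rule i) (simp_all add: ne)
  have i0: "integrable M (\<lambda>\<omega>. (1 - h (X \<omega>)) * (d (X \<omega>) / (1 - h (X \<omega>)))\<^sup>2)"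
    unfolding eq0 by (rule i) (simp_all add: ne)
  have s_eq: "s \<omega> = ?D \<omega> * (d (X \<omega>) / h (X \<omega>)) - ?E \<omega> * (d (X \<omega>) / (1 - h (X \<omega>)))"
    if "\<omega> \<in> space M" for \<omega>
    using ne[of "X \<omega>"] that unfolding s_def by (auto simp: indicator_def)
  have s2_eq: "(s \<omega>)\<^sup>2 = ?D \<omega> * (d (X \<omega>) / h (X \<omega>))\<^sup>2 + ?E \<omega> * (d (X \<omega>) / (1 - h (X \<omega>)))\<^sup>2"
    if "\<omega> \<in> space M" for \<omega>
    using that unfolding s_eq[OF that] by (auto simp: indicator_def)
  have j1: "integrable M (\<lambda>\<omega>. ?D \<omega> * (d (X \<omega>) / h (X \<omega>))\<^sup>2)"
    "expectation (\<lambda>\<omega>. ?D \<omega> * (d (X \<omega>) / h (X \<omega>))\<^sup>2) = expectation (\<lambda>\<omega>. h (X \<omega>) * (d (X \<omega>) / h (X \<omega>))\<^sup>2)"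
    using D1[of "\<lambda>x. (d x / h x)\<^sup>2"] i1 by auto
  have j0: "integrable M (\<lambda>\<omega>. ?E \<omega> * (d (X \<omega>) / (1 - h (X \<omega>)))\<^sup>2)"
    "expectation (\<lambda>\<omega>. ?E \<omega> * (d (X \<omega>) / (1 - h (X \<omega>)))\<^sup>2) =
      expectation (\<lambda>\<omega>. (1 - h (X \<omega>)) * (d (X \<omega>) / (1 - h (X \<omega>)))\<^sup>2)"
    using D0[of "\<lambda>x. (d x / (1 - h x))\<^sup>2"] i0 by auto
  show sq: "integrable M (\<lambda>\<omega>. (s \<omega>)\<^sup>2)"
    using Bochner_Integration.integrable_add[OF j1(1) j0(1)]
    by (simp only: s2_eq cong: Bochner_Integration.integrable_cong)
  have "expectation (\<lambda>\<omega>. (s \<omega>)\<^sup>2) =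
      expectation (\<lambda>\<omega>. ?D \<omega> * (d (X \<omega>) / h (X \<omega>))\<^sup>2 + ?E \<omega> * (d (X \<omega>) / (1 - h (X \<omega>)))\<^sup>2)"
    by (simp only: s2_eq cong: Bochner_Integration.integral_cong)
  also have "\<dots> = expectation (\<lambda>\<omega>. h (X \<omega>) * (d (X \<omega>) / h (X \<omega>))\<^sup>2 +
      (1 - h (X \<omega>)) * (d (X \<omega>) / (1 - h (X \<omega>)))\<^sup>2)"
    using i1 i0 j1 j0 by simp
  also have "\<dots> = expectation (\<lambda>\<omega>. ?w (X \<omega>) * (d (X \<omega>))\<^sup>2)"
    unfolding eq1 eq0 distrib_right[symmetric] by simp
  finally show "expectation (\<lambda>\<omega>. (s \<omega>)\<^sup>2) = expectation (\<lambda>\<omega>. ?w (X \<omega>) * (d (X \<omega>))\<^sup>2)" .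
  fix k :: "'b \<Rightarrow> real" and C
  assume [measurable]: "k \<in> borel_measurable N" and C: "\<And>x. \<bar>k x\<bar> \<le> C"
  have ints: "integrable M s"
    by (rule square_integrable_imp_integrable[OF _ sq]) simp
  then have intsC: "integrable M (\<lambda>\<omega>. C * s \<omega>)" by simp
  have C0: "C \<ge> 0" using C[of undefined] by linarith
  \<comment> \<open>On D this piece is s times k and elsewhere it is 0, so C |s| is a majorant; s is
    integrable because its square is.\<close>
  have k1: "integrable M (\<lambda>\<omega>. ?D \<omega> * (d (X \<omega>) / h (X \<omega>) * k (X \<omega>)))"
  proof (rule Bochner_Integration.integrable_bound[OF intsC])
    show "AE \<omega> in M. norm (?D \<omega> * (d (X \<omega>) / h (X \<omega>) * k (X \<omega>))) \<le> norm (C * s \<omega>)"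
    proof (rule AE_I2)
      fix \<omega> assume "\<omega> \<in> space M"
      then show "norm (?D \<omega> * (d (X \<omega>) / h (X \<omega>) * k (X \<omega>))) \<le> norm (C * s \<omega>)"
        using C[of "X \<omega>"] C0 mult_right_mono[OF C, of "\<bar>d (X \<omega>) / h (X \<omega>)\<bar>" "X \<omega>"]
        unfolding s_eq[OF \<open>\<omega> \<in> space M\<close>] by (auto simp: indicator_def abs_mult mult_ac)
    qed
  qed measurable
  have k0: "integrable M (\<lambda>\<omega>. ?E \<omega> * (d (X \<omega>) / (1 - h (X \<omega>)) * k (X \<omega>)))"
  proof (rule Bochner_Integration.integrable_bound[OF intsC])
    show "AE \<omega> in M. norm (?E \<omega> * (d (X \<omega>) / (1 - h (X \<omega>)) * k (X \<omega>))) \<le> norm (C * s \<omega>)"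
    proof (rule AE_I2)
      fix \<omega> assume "\<omega> \<in> space M"
      then show "norm (?E \<omega> * (d (X \<omega>) / (1 - h (X \<omega>)) * k (X \<omega>))) \<le> norm (C * s \<omega>)"
        using C[of "X \<omega>"] C0 mult_right_mono[OF C, of "\<bar>d (X \<omega>) / (1 - h (X \<omega>))\<bar>" "X \<omega>"]
        unfolding s_eq[OF \<open>\<omega> \<in> space M\<close>] by (auto simp: indicator_def abs_mult mult_ac)
    qed
  qed measurable
  \<comment> \<open>Conditioning multiplies each half by exactly its denominator, so both halves
    have expectation E[d(X) k(X)] and cancel.\<close>
  have "expectation (\<lambda>\<omega>. s \<omega> * k (X \<omega>)) =
      expectation (\<lambda>\<omega>. ?D \<omega> * (d (X \<omega>) / h (X \<omega>) * k (X \<omega>)) -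
        ?E \<omega> * (d (X \<omega>) / (1 - h (X \<omega>)) * k (X \<omega>)))"
    by (rule Bochner_Integration.integral_cong[OF refl]) (simp only: s_eq left_diff_distrib mult.assoc)
  also have "\<dots> = expectation (\<lambda>\<omega>. ?D \<omega> * (d (X \<omega>) / h (X \<omega>) * k (X \<omega>))) -
      expectation (\<lambda>\<omega>. ?E \<omega> * (d (X \<omega>) / (1 - h (X \<omega>)) * k (X \<omega>)))"
    using k1 k0 by (rule Bochner_Integration.integral_diff)
  also have "expectation (\<lambda>\<omega>. ?D \<omega> * (d (X \<omega>) / h (X \<omega>) * k (X \<omega>))) = expectation (\<lambda>\<omega>. d (X \<omega>) * k (X \<omega>))"
    using D1(2)[of "\<lambda>x. d x / h x * k x"] ne by simp
  also have "expectation (\<lambda>\<omega>. ?E \<omega> * (d (X \<omega>) / (1 - h (X \<omega>)) * k (X \<omega>))) = expectation (\<lambda>\<omega>. d (X \<omega>) * k (X \<omega>))"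
    using D0(2)[of "\<lambda>x. d x / (1 - h x) * k x"] ne by simp
  finally show "expectation (\<lambda>\<omega>. s \<omega> * k (X \<omega>)) = 0" by simp
qed

end

section \<open>Gradients\<close>

text \<open>In finite dimension every derivative is an inner product with the vector of its values
  on the basis.\<close>

lemma GDERIV_gradient:
  fixes f :: "'p::euclidean_space \<Rightarrow> real"
  assumes "f differentiable (at x)"
  shows "GDERIV f x :> gradient f x"
proof -
  obtain f' where f': "(f has_derivative f') (at x)"
    using assms by (auto simp: differentiable_def)
  then have lin: "linear f'" by (rule has_derivative_linear)
  let ?D = "\<Sum>b\<in>Basis. f' b *\<^sub>R b"
  have f'_eq: "f' = (\<lambda>h. h \<bullet> ?D)"
  proof
    fix h
    have "f' h = f' (\<Sum>b\<in>Basis. (h \<bullet> b) *\<^sub>R b)" by (simp add: euclidean_representation)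
    also have "\<dots> = h \<bullet> ?D"
      using lin by (simp add: linear_sum linear_cmul inner_sum_right mult.commute)
    finally show "f' h = h \<bullet> ?D" .
  qed
  have "GDERIV f x :> ?D"
    unfolding gderiv_def by (rule has_derivative_eq_rhs[OF f' f'_eq])
  then show ?thesis by (simp add: gradient_eqI)
qed

text \<open>Mean value inequality for f minus the linear map z \<mapsto> z \<bullet> D x, whose
  gradient at z is D z - D x. Only the oscillation of the gradient enters, with no second
  derivative.\<close>

lemma GDERIV_first_order_bound:
  fixes f :: "'p::euclidean_space \<Rightarrow> real"
  assumes D: "\<And>z. z \<in> ball x \<delta> \<Longrightarrow> GDERIV f z :> D z"
    and K: "\<And>z. z \<in> ball x \<delta> \<Longrightarrow> norm (D z - D x) \<le> K"
    and y: "y \<in> ball x \<delta>"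
  shows "\<bar>f y - f x - (y - x) \<bullet> D x\<bar> \<le> K * norm (y - x)"
proof -
  have K0: "0 \<le> K" using K[OF y] norm_ge_zero order_trans by blast
  have xin: "x \<in> ball x \<delta>" using y by (auto simp: dist_commute intro: le_less_trans[OF zero_le_dist])
  have "norm ((f y - y \<bullet> D x) - (f x - x \<bullet> D x)) \<le> K * norm (y - x)"
  proof (rule differentiable_bound[OF convex_ball _ _ y xin])
    fix z assume z: "z \<in> ball x \<delta>"
    have "(f has_derivative (\<lambda>h. h \<bullet> D z)) (at z)"
      using D[OF z] unfolding gderiv_def .
    then have "((\<lambda>z. f z - z \<bullet> D x) has_derivative (\<lambda>h. h \<bullet> D z - h \<bullet> D x)) (at z)"
      by (auto intro!: derivative_eq_intros)
    then show "((\<lambda>z. f z - z \<bullet> D x) has_derivative (\<lambda>h. h \<bullet> (D z - D x))) (at z within ball x \<delta>)"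
      by (simp add: inner_diff_right has_derivative_at_withinI)
    show "onorm (\<lambda>h. h \<bullet> (D z - D x)) \<le> K"
    proof (rule onorm_bound[OF K0])
      fix h
      have "norm (h \<bullet> (D z - D x)) \<le> norm h * norm (D z - D x)"
        using Cauchy_Schwarz_ineq2 by auto
      also have "\<dots> \<le> norm h * K" using K[OF z] by (intro mult_left_mono) auto
      finally show "norm (h \<bullet> (D z - D x)) \<le> K * norm h" by (simp add: mult.commute)
    qed
  qed
  then show ?thesis by (simp add: inner_diff_left algebra_simps)
qed

text \<open>Each coordinate of the gradient is a limit of difference quotients along a basis vector,
  and these are measurable in t.\<close>

lemma borel_measurable_gradient:
  fixes g :: "'b \<Rightarrow> 'p::euclidean_space \<Rightarrow> real"
  assumes U: "open U" "\<eta> \<in> U"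
    and diff: "\<And>t. g t differentiable_on U"
    and meas: "\<And>\<eta>. \<eta> \<in> U \<Longrightarrow> (\<lambda>t. g t \<eta>) \<in> borel_measurable N"
  shows "(\<lambda>t. gradient (g t) \<eta>) \<in> borel_measurable N"
proof -
  have "(\<lambda>t. gradient (g t) \<eta> \<bullet> b) \<in> borel_measurable N" if b: "b \<in> Basis" for b
  proof -
    obtain e where e: "e > 0" "ball \<eta> e \<subseteq> U" using U openE by blast
    obtain m :: nat where m: "m > 0" "1 / real m < e" using e(1) nat_approx_posE by (metis of_nat_0_less_iff zero_less_Suc)
    \<comment> \<open>The shift by m keeps every step length below the radius e, so all evaluation
      points lie in U, where measurability is available.\<close>
    define s where "s n = 1 / real (n + m)" for n
    have s: "s n > 0" "s n < e" for n
    proof -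
      show "s n > 0" unfolding s_def using m by simp
      have "s n \<le> 1 / real m" unfolding s_def using m by (intro divide_left_mono) auto
      then show "s n < e" using m by simp
    qed
    have in_U: "\<eta> + s n *\<^sub>R b \<in> U" for n
      using e s[of n] b by (intro subsetD[OF e(2)]) (simp add: dist_norm)
    show ?thesis
    proof (rule borel_measurable_LIMSEQ_real)
      fix t
      have "g t differentiable (at \<eta>)"
        using diff U by (simp add: differentiable_on_eq_differentiable_at)
      then have "(g t has_derivative (\<lambda>h. h \<bullet> gradient (g t) \<eta>)) (at \<eta>)"
        using GDERIV_gradient unfolding gderiv_def by blast
      then have "((\<lambda>x. g t (\<eta> + x *\<^sub>R b)) has_derivative (\<lambda>x. (x *\<^sub>R b) \<bullet> gradient (g t) \<eta>)) (at 0)"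
        by (intro has_derivative_compose[of "\<lambda>x. \<eta> + x *\<^sub>R b" "\<lambda>x. x *\<^sub>R b" 0 UNIV "g t"])
           (auto intro!: derivative_eq_intros)
      then have "((\<lambda>x. g t (\<eta> + x *\<^sub>R b)) has_field_derivative (b \<bullet> gradient (g t) \<eta>)) (at 0)"
        unfolding has_field_derivative_def by (simp add: mult_commute_abs)
      then have "((\<lambda>x. (g t (\<eta> + x *\<^sub>R b) - g t \<eta>) / x) \<longlongrightarrow> b \<bullet> gradient (g t) \<eta>) (at 0)"
        by (simp add: DERIV_def)
      moreover have "filterlim s (at 0) sequentially"
      proof (rule filterlim_atI)
        show "s \<longlonglongrightarrow> 0" unfolding s_def
          by (rule LIMSEQ_ignore_initial_segment[of "\<lambda>n. 1 / real n"]) real_asymp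
        show "\<forall>\<^sub>F n in sequentially. s n \<noteq> 0" using s by (simp add: less_imp_neq[symmetric])
      qed
      ultimately show "(\<lambda>n. (g t (\<eta> + s n *\<^sub>R b) - g t \<eta>) / s n) \<longlonglongrightarrow> gradient (g t) \<eta> \<bullet> b"
        by (auto simp: inner_commute intro: filterlim_compose)
    next
      fix n
      show "(\<lambda>t. (g t (\<eta> + s n *\<^sub>R b) - g t \<eta>) / s n) \<in> borel_measurable N"
        using meas in_U U(2) by measurable
    qed
  qed
  then show ?thesis by (subst borel_measurable_euclidean_space) auto
qed

text \<open>The supremum over a countable dense set makes the modulus of continuity measurable; by
  continuity it still dominates the increments at all points of the ball.\<close>

lemma gradient_modulus_exists:
  fixes g :: "'b \<Rightarrow> 'p::euclidean_space \<Rightarrow> real"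
  assumes U: "open U" "\<theta> \<in> U"
    and diff: "\<And>t. g t differentiable_on U" and cont: "\<And>t. continuous_on U (gradient (g t))"
    and meas: "\<And>\<eta>. \<eta> \<in> U \<Longrightarrow> (\<lambda>t. g t \<eta>) \<in> borel_measurable N"
    and X [measurable]: "X \<in> measurable M N"
    and fin: "(\<integral>\<^sup>+\<omega>. (SUP \<eta>\<in>U. ennreal (norm (gradient (g (X \<omega>)) \<eta>))) \<partial>M) < \<infinity>"
    and "e > 0"
  obtains \<delta> H where "\<delta> > 0" "ball \<theta> \<delta> \<subseteq> U" "H \<in> borel_measurable N" "(\<integral>\<^sup>+\<omega>. H (X \<omega>) \<partial>M) < ennreal e"
    "\<And>t \<eta>. \<eta> \<in> ball \<theta> \<delta> \<Longrightarrow> ennreal (norm (gradient (g t) \<eta> - gradient (g t) \<theta>)) \<le> H t"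
proof -
  obtain D0 :: "'p set" where D0: "countable D0" "\<And>V. open V \<Longrightarrow> V \<noteq> {} \<Longrightarrow> \<exists>d\<in>D0. d \<in> V"
    using countable_dense_exists by blast
  \<comment> \<open>With \<open>\<theta>\<close> in the dense set, the majorant G below also bounds
    the gradient at \<open>\<theta>\<close>, as needed when the modulus is compared with 2
    G.\<close>
  define D where "D = insert \<theta> D0"
  have D: "countable D" "\<theta> \<in> D" "\<And>V. open V \<Longrightarrow> V \<noteq> {} \<Longrightarrow> \<exists>d\<in>D. d \<in> V"
    using D0 by (auto simp: D_def)
  obtain e0 where e0: "e0 > 0" "ball \<theta> e0 \<subseteq> U" using U openE by blast
  define \<delta> where "\<delta> n = e0 / real (Suc n)" for n
  have \<delta>0: "\<delta> n > 0" for n using e0 by (simp add: \<delta>_def)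
  have \<delta>mono: "\<delta> (Suc n) \<le> \<delta> n" for n
    unfolding \<delta>_def using e0 by (intro divide_left_mono) auto
  have \<delta>U: "ball \<theta> (\<delta> n) \<subseteq> U" for n
  proof -
    have "\<delta> n \<le> e0" unfolding \<delta>_def using e0 by (simp add: divide_le_eq)
    then show ?thesis using e0(2) subset_ball by blast
  qed
  have [measurable]: "(\<lambda>t. gradient (g t) \<eta>) \<in> borel_measurable N" if "\<eta> \<in> U" for \<eta>
    using borel_measurable_gradient[OF U(1) that diff meas] .
  define H where "H n t = (SUP \<eta>\<in>D \<inter> ball \<theta> (\<delta> n). ennreal (norm (gradient (g t) \<eta> - gradient (g t) \<theta>)))" for n t
  define G where "G t = (SUP \<eta>\<in>D \<inter> U. ennreal (norm (gradient (g t) \<eta>)))" for t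
  have H_meas [measurable]: "H n \<in> borel_measurable N" for n
    unfolding H_def using D(1) U(2) \<delta>U[of n] by (intro borel_measurable_SUP) (auto intro!: measurable)
  have G_meas [measurable]: "G \<in> borel_measurable N"
    unfolding G_def using D(1) by (intro borel_measurable_SUP) (auto intro!: measurable)
  have H_le: "ennreal (norm (gradient (g t) \<eta> - gradient (g t) \<theta>)) \<le> H n t" if \<eta>: "\<eta> \<in> ball \<theta> (\<delta> n)" for n t \<eta>
  proof (rule ccontr)
    let ?f = "\<lambda>\<eta>. ennreal (norm (gradient (g t) \<eta> - gradient (g t) \<theta>))"
    assume "\<not> ?f \<eta> \<le> H n t"
    then have ne: "\<eta> \<in> ?f -` {H n t<..} \<inter> ball \<theta> (\<delta> n)" using \<eta> by auto
    have "continuous_on (ball \<theta> (\<delta> n)) ?f"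
      by (intro continuous_on_ennreal continuous_intros continuous_on_subset[OF cont \<delta>U])
    then have "open (?f -` {H n t<..} \<inter> ball \<theta> (\<delta> n))"
      by (rule continuous_on_open_vimage[THEN iffD1, OF open_ball, rule_format]) simp
    with ne obtain d where "d \<in> D" "d \<in> ?f -` {H n t<..} \<inter> ball \<theta> (\<delta> n)"
      using D(3) by (metis empty_iff)
    moreover from this have "?f d \<le> H n t" unfolding H_def by (intro SUP_upper) auto
    ultimately show False by auto
  qed
  have H_dec: "H (Suc n) t \<le> H n t" for n t
    unfolding H_def using \<delta>mono[of n] by (intro SUP_subset_mono) auto
  have H_lim: "(INF n. H n t) = 0" for t
  proof -
    have le: "(INF n. H n t) \<le> 0 + ennreal c" if "c > 0" for c
    proof -
      have "isCont (gradient (g t)) \<theta>"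
        using cont U by (simp add: continuous_on_eq_continuous_at)
      then obtain d where d: "d > 0" "\<And>\<eta>. dist \<eta> \<theta> < d \<Longrightarrow> dist (gradient (g t) \<eta>) (gradient (g t) \<theta>) < c"
        using \<open>c > 0\<close> unfolding continuous_at_eps_delta by blast
      have "\<delta> \<longlonglongrightarrow> 0" unfolding \<delta>_def by real_asymp
      then have "\<forall>\<^sub>F n in sequentially. \<delta> n < d" using d(1) by (rule order_tendstoD)
      then obtain n where n: "\<delta> n < d" by (auto simp: eventually_sequentially)
      have "H n t \<le> ennreal c"
        unfolding H_def
      proof (rule SUP_least)
        fix \<eta> assume "\<eta> \<in> D \<inter> ball \<theta> (\<delta> n)"
        then have "dist \<eta> \<theta> < d" using n by (auto simp: dist_commute)
        from d(2)[OF this] show "ennreal (norm (gradient (g t) \<eta> - gradient (g t) \<theta>)) \<le> ennreal c"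
          by (intro ennreal_leI) (simp add: dist_norm)
      qed
      then show ?thesis by (simp only: add_0) (rule INF_lower2[OF UNIV_I])
    qed
    have "(INF n. H n t) \<le> 0"
      by (rule ennreal_le_epsilon) (rule le)
    then show ?thesis by simp
  qed
  \<comment> \<open>Monotone convergence for the decreasing sequence H n needs one finite integral;
    the triangle inequality and the domination of g' on U provide it at n = 0.\<close>
  have fin0: "(\<integral>\<^sup>+\<omega>. H 0 (X \<omega>) \<partial>M) < \<infinity>"
  proof -
    have "H 0 t \<le> 2 * G t" for t
      unfolding H_def
    proof (rule SUP_least)
      fix \<eta> assume \<eta>: "\<eta> \<in> D \<inter> ball \<theta> (\<delta> 0)"
      have "ennreal (norm (gradient (g t) \<eta> - gradient (g t) \<theta>)) \<le>
          ennreal (norm (gradient (g t) \<eta>)) + ennreal (norm (gradient (g t) \<theta>))"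
        by (simp add: ennreal_plus[symmetric] norm_triangle_ineq4 del: ennreal_plus)
      also have "\<dots> \<le> G t + G t"
        unfolding G_def using \<eta> \<delta>U[of 0] D(2) U(2) by (intro add_mono SUP_upper) auto
      finally show "ennreal (norm (gradient (g t) \<eta> - gradient (g t) \<theta>)) \<le> 2 * G t"
        by (simp add: mult_2)
    qed
    then have "(\<integral>\<^sup>+\<omega>. H 0 (X \<omega>) \<partial>M) \<le> (\<integral>\<^sup>+\<omega>. 2 * G (X \<omega>) \<partial>M)"
      by (intro nn_integral_mono) auto
    also have "\<dots> = 2 * (\<integral>\<^sup>+\<omega>. G (X \<omega>) \<partial>M)" by (rule nn_integral_cmult) simp
    also have "(\<integral>\<^sup>+\<omega>. G (X \<omega>) \<partial>M) \<le> (\<integral>\<^sup>+\<omega>. (SUP \<eta>\<in>U. ennreal (norm (gradient (g (X \<omega>)) \<eta>))) \<partial>M)"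
      unfolding G_def by (intro nn_integral_mono SUP_subset_mono) auto
    also have "2 * \<dots> < \<infinity>" using fin by (simp add: ennreal_mult_less_top)
    finally show ?thesis by (simp add: mult_left_mono)
  qed
  have "(INF n. (\<integral>\<^sup>+\<omega>. H n (X \<omega>) \<partial>M)) = (\<integral>\<^sup>+\<omega>. (INF n. H n (X \<omega>)) \<partial>M)"
    using fin0 by (intro nn_integral_monotone_convergence_INF_AE[symmetric, where i=0]) (auto simp: H_dec)
  also have "\<dots> < ennreal e" using \<open>e > 0\<close> by (simp add: H_lim)
  finally obtain n where "(\<integral>\<^sup>+\<omega>. H n (X \<omega>) \<partial>M) < ennreal e"
    by (auto simp: INF_less_iff)
  then show ?thesis using that[OF \<delta>0 \<delta>U H_meas _ H_le] by blast
qed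

section \<open>Markov's inequality for sums along the sample\<close>

context iid_sequence
begin

text \<open>All summands have the same integral, so the n terms cancel the n in the threshold and
  the bound is uniform in n. Extended nonnegative values are kept because a modulus defined as a
  supremum may be infinite.\<close>

lemma emeasure_sum_ge_le:
  assumes [measurable]: "h \<in> borel_measurable S" and "\<epsilon> > 0" "n > 0"
  shows "emeasure M {\<omega> \<in> space M. ennreal (real n * \<epsilon>) \<le> (\<Sum>i=1..n. h (W i \<omega>))} \<le>
    ennreal (1 / \<epsilon>) * (\<integral>\<^sup>+\<omega>. h (W 0 \<omega>) \<partial>M)"
proof -
  let ?c = "ennreal (1 / (real n * \<epsilon>))"
  have "emeasure M {\<omega> \<in> space M. ennreal (real n * \<epsilon>) \<le> (\<Sum>i=1..n. h (W i \<omega>))} \<le>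
      emeasure M ({\<omega> \<in> space M. 1 \<le> ?c * (\<Sum>i=1..n. h (W i \<omega>))} \<inter> space M)"
  proof (rule emeasure_mono)
    have "1 \<le> ?c * x" if "ennreal (real n * \<epsilon>) \<le> x" for x
      using mult_left_mono[OF that, of ?c] assms by (simp add: ennreal_mult''[symmetric])
    then show "{\<omega> \<in> space M. ennreal (real n * \<epsilon>) \<le> (\<Sum>i=1..n. h (W i \<omega>))} \<subseteq>
      {\<omega> \<in> space M. 1 \<le> ?c * (\<Sum>i=1..n. h (W i \<omega>))} \<inter> space M" by auto
  qed measurable
  also have "\<dots> \<le> ?c * (\<integral>\<^sup>+\<omega>. (\<Sum>i=1..n. h (W i \<omega>)) * indicator (space M) \<omega> \<partial>M)"
    using nn_integral_Markov_inequality[of "\<lambda>\<omega>. \<Sum>i=1..n. h (W i \<omega>)" "space M" M ?c]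
    by (simp add: Int_def conj_commute)
  also have "(\<integral>\<^sup>+\<omega>. (\<Sum>i=1..n. h (W i \<omega>)) * indicator (space M) \<omega> \<partial>M) = (\<integral>\<^sup>+\<omega>. (\<Sum>i=1..n. h (W i \<omega>)) \<partial>M)"
    by (rule nn_integral_cong) simp
  also have "\<dots> = (\<Sum>i=1..n. (\<integral>\<^sup>+\<omega>. h (W i \<omega>) \<partial>M))"
    by (rule nn_integral_sum) simp
  also have "\<dots> = (\<Sum>i=1..n. (\<integral>\<^sup>+\<omega>. h (W 0 \<omega>) \<partial>M))"
    by (rule sum.cong[OF refl nn_integral_compose_eq]) simp
  also have "?c * \<dots> = (?c * ennreal (real n)) * (\<integral>\<^sup>+\<omega>. h (W 0 \<omega>) \<partial>M)"
    by (simp add: mult.assoc ennreal_of_nat_eq_real_of_nat)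
  also have "?c * ennreal (real n) = ennreal (1 / \<epsilon>)"
    using assms by (simp add: ennreal_mult''[symmetric])
  finally show ?thesis .
qed

end

section \<open>The score\<close>

locale semiparametric_sample =
  iid_sequence M "borel \<Otimes>\<^sub>M borel" "\<lambda>i \<omega>. (X i \<omega>, Y i \<omega>)"
  for M :: "'a measure" and X :: "nat \<Rightarrow> 'a \<Rightarrow> real^'f::finite" and Y :: "nat \<Rightarrow> 'a \<Rightarrow> real" +
  fixes g :: "real^'f \<Rightarrow> real^'p::finite \<Rightarrow> real"
    and \<Theta> U :: "(real^'p) set" and \<theta> :: "real^'p" and A :: "real^'p^'p" and B :: "real^'p"
  assumes binary: "\<And>i \<omega>. \<omega> \<in> space M \<Longrightarrow> Y i \<omega> \<in> {0, 1}"
    and g_measurable: "(\<lambda>(t, \<eta>). g t \<eta>) \<in> borel_measurable (borel \<Otimes>\<^sub>M restrict_space borel \<Theta>)"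
    and g_bounds: "\<And>t \<eta>. \<eta> \<in> \<Theta> \<Longrightarrow> 0 < g t \<eta> \<and> g t \<eta> < 1"
    and model: "AE \<omega> in M. real_cond_exp M (vimage_algebra (space M) (X 0) borel)
                       (indicator {\<omega> \<in> space M. Y 0 \<omega> = 1}) \<omega> = g (X 0 \<omega>) \<theta>"
    and U: "open U" "\<theta> \<in> U" "U \<subseteq> \<Theta>"
    and g_diff: "\<And>t. g t differentiable_on U" and g_cont: "\<And>t. continuous_on U (gradient (g t))"
    and gradient_dominated:
      "(\<integral>\<^sup>+\<omega>. (SUP \<eta>\<in>U. ennreal (norm (gradient (g (X 0 \<omega>)) \<eta>))) \<partial>M) < \<infinity>"
    and info_integrable: "integrable M (\<lambda>\<omega>. info_integrand g (X 0 \<omega>) \<theta>)"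
    and A_eq: "A = (\<integral>\<omega>. info_integrand g (X 0 \<omega>) \<theta> \<partial>M)"
    and A_invertible: "invertible A"
    and B_eq: "B = (\<integral>\<omega>. gradient (g (X 0 \<omega>)) \<theta> \<partial>M)"
begin

lemma XY_measurable [measurable]: "random_variable borel (X i)" "random_variable borel (Y i)"
  using measurable_compose[OF W_measurable measurable_fst] measurable_compose[OF W_measurable measurable_snd]
  by auto

lemma g_measurable_compose:
  assumes [measurable]: "f \<in> borel_measurable N" and "h \<in> measurable N (restrict_space borel \<Theta>)"
  shows "(\<lambda>x. g (f x) (h x)) \<in> borel_measurable N"
  using measurable_compose[OF measurable_Pair[OF assms] g_measurable] by simp

lemma g_measurable_fixed [measurable]: "\<eta> \<in> \<Theta> \<Longrightarrow> (\<lambda>t. g t \<eta>) \<in> borel_measurable borel"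
  by (rule g_measurable_compose) (auto simp: space_restrict_space)

lemma theta_mem [simp]: "\<theta> \<in> \<Theta>"
  using U by auto

lemma gradient_measurable [measurable]: "(\<lambda>t. gradient (g t) \<theta>) \<in> borel_measurable borel"
  using U by (intro borel_measurable_gradient[OF U(1,2) g_diff]) auto

lemma score_measurable [measurable]:
  "(\<lambda>p. score g (fst p) (snd p) \<theta>) \<in> borel_measurable (borel \<Otimes>\<^sub>M borel)"
  unfolding score_def weight_def by measurable

lemma quadratic_form_info:
  "v \<bullet> (info_integrand g x \<theta> *v v) = weight g x \<theta> * (v \<bullet> gradient (g x) \<theta>)\<^sup>2"
  by (simp add: info_integrand_def inner_vec_def matrix_vector_mult_def power2_eq_square
      sum_product sum_distrib_left mult_ac)

text \<open>For fixed v the map m \<mapsto> v \<bullet> (m *v v) is bounded linear, hence commutes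
  with the matrix-valued integral; the integrand has rank one, which yields the square.\<close>

lemma quadratic_form_A:
  "integrable M (\<lambda>\<omega>. weight g (X 0 \<omega>) \<theta> * (v \<bullet> gradient (g (X 0 \<omega>)) \<theta>)\<^sup>2)"
  "expectation (\<lambda>\<omega>. weight g (X 0 \<omega>) \<theta> * (v \<bullet> gradient (g (X 0 \<omega>)) \<theta>)\<^sup>2) = v \<bullet> (A *v v)"
proof -
  have "linear (\<lambda>m :: real^'p^'p. v \<bullet> (m *v v))"
    by (rule linearI) (simp_all add: matrix_vector_mult_add_rdistrib inner_add_right
        scaleR_matrix_vector_assoc[symmetric])
  then have lin: "bounded_linear (\<lambda>m :: real^'p^'p. v \<bullet> (m *v v))"
    by (simp add: linear_conv_bounded_linear)
  show "integrable M (\<lambda>\<omega>. weight g (X 0 \<omega>) \<theta> * (v \<bullet> gradient (g (X 0 \<omega>)) \<theta>)\<^sup>2)"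
    using integrable_bounded_linear[OF lin info_integrable] by (simp add: quadratic_form_info)
  show "expectation (\<lambda>\<omega>. weight g (X 0 \<omega>) \<theta> * (v \<bullet> gradient (g (X 0 \<omega>)) \<theta>)\<^sup>2) = v \<bullet> (A *v v)"
    using integral_bounded_linear[OF lin info_integrable] by (simp add: quadratic_form_info A_eq)
qed

lemma A_symmetric: "transpose A = A"
proof -
  have "transpose (info_integrand g x \<theta>) = info_integrand g x \<theta>" for x
    by (simp add: info_integrand_def transpose_def vec_eq_iff mult.commute)
  moreover have "bounded_linear (transpose :: real^'p^'p \<Rightarrow> real^'p^'p)"
    unfolding linear_conv_bounded_linear[symmetric]
    by (rule linearI) (simp_all add: transpose_def vec_eq_iff)
  ultimately show ?thesis
    using integral_bounded_linear[OF _ info_integrable, of transpose] by (simp add: A_eq)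
qed

lemma cond_prob_label:
  "Q \<in> sets borel \<Longrightarrow> prob ({\<omega> \<in> space M. Y 0 \<omega> = 1} \<inter> (X 0 -` Q \<inter> space M)) =
     expectation (\<lambda>\<omega>. indicator Q (X 0 \<omega>) * g (X 0 \<omega>) \<theta>)"
  using real_cond_exp_cond_prob[where N = borel and X = "X 0" and h = "\<lambda>x. g x \<theta>"
      and D = "{\<omega> \<in> space M. Y 0 \<omega> = 1}", OF _ _ _ model] by simp

lemma indicator_label: "\<omega> \<in> space M \<Longrightarrow> indicator {\<omega> \<in> space M. Y 0 \<omega> = 1} \<omega> = Y 0 \<omega>"
  using binary[of \<omega> 0] by (auto simp: indicator_def)

text \<open>The weighted residual with d = v \<bullet> g'. The weight 1 / (g (1 - g)) is the inverse
  conditional variance of the label, so the covariance matrix of the score is A itself. The third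
  claim gives the zero mean, with k = 1, and the vanishing covariance with g(X, \<theta>).\<close>

lemma score_moments:
  shows "integrable M (\<lambda>\<omega>. (v \<bullet> score g (X 0 \<omega>) (Y 0 \<omega>) \<theta>)\<^sup>2)"
    and "expectation (\<lambda>\<omega>. (v \<bullet> score g (X 0 \<omega>) (Y 0 \<omega>) \<theta>)\<^sup>2) = v \<bullet> (A *v v)"
    and "\<And>k C. k \<in> borel_measurable borel \<Longrightarrow> (\<And>x. \<bar>k x\<bar> \<le> C) \<Longrightarrow>
      expectation (\<lambda>\<omega>. v \<bullet> score g (X 0 \<omega>) (Y 0 \<omega>) \<theta> * k (X 0 \<omega>)) = 0"
proof -
  let ?D = "{\<omega> \<in> space M. Y 0 \<omega> = 1}"
  let ?s = "\<lambda>\<omega>. 1 / (g (X 0 \<omega>) \<theta> * (1 - g (X 0 \<omega>) \<theta>)) * (indicator ?D \<omega> - g (X 0 \<omega>) \<theta>) *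
    (v \<bullet> gradient (g (X 0 \<omega>)) \<theta>)"
  have s: "v \<bullet> score g (X 0 \<omega>) (Y 0 \<omega>) \<theta> = ?s \<omega>" if "\<omega> \<in> space M" for \<omega>
    unfolding indicator_label[OF that] by (simp add: score_def weight_def)
  have int: "integrable M (\<lambda>\<omega>. 1 / (g (X 0 \<omega>) \<theta> * (1 - g (X 0 \<omega>) \<theta>)) * (v \<bullet> gradient (g (X 0 \<omega>)) \<theta>)\<^sup>2)"
    using quadratic_form_A(1)[of v] by (simp add: weight_def)
  have D: "?D \<in> events" by measurable
  have b: "0 < g x \<theta>" "g x \<theta> < 1" for x using g_bounds by auto
  have m: "(\<lambda>x. g x \<theta>) \<in> borel_measurable borel" by simp
  have d: "(\<lambda>x. v \<bullet> gradient (g x) \<theta>) \<in> borel_measurable borel" by simp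
  note * = weighted_residual_moments[where N = borel and X = "X 0" and D = ?D
      and h = "\<lambda>x. g x \<theta>" and d = "\<lambda>x. v \<bullet> gradient (g x) \<theta>",
      OF XY_measurable(1) D m d b cond_prob_label int]
  show "integrable M (\<lambda>\<omega>. (v \<bullet> score g (X 0 \<omega>) (Y 0 \<omega>) \<theta>)\<^sup>2)"
    using *(1) by (simp only: s cong: Bochner_Integration.integrable_cong)
  have "expectation (\<lambda>\<omega>. (v \<bullet> score g (X 0 \<omega>) (Y 0 \<omega>) \<theta>)\<^sup>2) = expectation (\<lambda>\<omega>. (?s \<omega>)\<^sup>2)"
    by (simp only: s cong: Bochner_Integration.integral_cong)
  also have "\<dots> = v \<bullet> (A *v v)"
    using *(2) quadratic_form_A(2)[of v] by (simp add: weight_def)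
  finally show "expectation (\<lambda>\<omega>. (v \<bullet> score g (X 0 \<omega>) (Y 0 \<omega>) \<theta>)\<^sup>2) = v \<bullet> (A *v v)" .
  fix k :: "real^'f \<Rightarrow> real" and C
  assume k: "k \<in> borel_measurable borel" "\<And>x. \<bar>k x\<bar> \<le> C"
  have "expectation (\<lambda>\<omega>. v \<bullet> score g (X 0 \<omega>) (Y 0 \<omega>) \<theta> * k (X 0 \<omega>)) = expectation (\<lambda>\<omega>. ?s \<omega> * k (X 0 \<omega>))"
    by (simp only: s cong: Bochner_Integration.integral_cong)
  also have "\<dots> = 0" using *(3)[OF _ k] by simp
  finally show "expectation (\<lambda>\<omega>. v \<bullet> score g (X 0 \<omega>) (Y 0 \<omega>) \<theta> * k (X 0 \<omega>)) = 0" .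
qed

lemma score_mean: "expectation (\<lambda>\<omega>. v \<bullet> score g (X 0 \<omega>) (Y 0 \<omega>) \<theta>) = 0"
  using score_moments(3)[of "\<lambda>_. 1" 1 v] by simp

lemma score_square_integrable: "integrable M (\<lambda>\<omega>. (norm (score g (X 0 \<omega>) (Y 0 \<omega>) \<theta>))\<^sup>2)"
  unfolding norm_square_Basis by (rule Bochner_Integration.integrable_sum) (rule score_moments)

lemma score_measurable_sample [measurable]: "random_variable borel (\<lambda>\<omega>. score g (X i \<omega>) (Y i \<omega>) \<theta>)"
  using measurable_compose[OF W_measurable score_measurable, of i] by simp

lemma score_vector_mean: "expectation (\<lambda>\<omega>. score g (X 0 \<omega>) (Y 0 \<omega>) \<theta>) = 0"
proof -
  have "integrable M (\<lambda>\<omega>. norm (score g (X 0 \<omega>) (Y 0 \<omega>) \<theta>))"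
    by (rule square_integrable_imp_integrable[OF _ score_square_integrable]) simp
  then have "integrable M (\<lambda>\<omega>. score g (X 0 \<omega>) (Y 0 \<omega>) \<theta>)"
    by (simp add: integrable_norm_iff)
  then have "v \<bullet> expectation (\<lambda>\<omega>. score g (X 0 \<omega>) (Y 0 \<omega>) \<theta>) = 0" for v
    using score_mean[of v] by simp
  then show ?thesis by (metis inner_eq_zero_iff)
qed

text \<open>Since g (1 - g) is at most 1, the weight is at least 1, and the diagonal quadratic forms
  of A dominate the squared coordinates of the gradient.\<close>

lemma gradient_square_integrable: "integrable M (\<lambda>\<omega>. (norm (gradient (g (X 0 \<omega>)) \<theta>))\<^sup>2)"
  unfolding norm_square_Basis
proof (rule Bochner_Integration.integrable_sum)
  fix b :: "real^'p"
  have w: "1 \<le> weight g x \<theta>" for x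
  proof -
    have "g x \<theta> * (1 - g x \<theta>) \<le> 1 * 1"
      using g_bounds[of \<theta> x] by (intro mult_mono) auto
    then show ?thesis using g_bounds[of \<theta> x] by (simp add: weight_def)
  qed
  show "integrable M (\<lambda>\<omega>. (b \<bullet> gradient (g (X 0 \<omega>)) \<theta>)\<^sup>2)"
  proof (rule Bochner_Integration.integrable_bound[OF quadratic_form_A(1)[of b]])
    have "(b \<bullet> gradient (g x) \<theta>)\<^sup>2 \<le> weight g x \<theta> * (b \<bullet> gradient (g x) \<theta>)\<^sup>2" for x
      using mult_right_mono[OF w[of x], of "(b \<bullet> gradient (g x) \<theta>)\<^sup>2"] by simp
    then show "AE \<omega> in M. norm ((b \<bullet> gradient (g (X 0 \<omega>)) \<theta>)\<^sup>2) \<le>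
        norm (weight g (X 0 \<omega>) \<theta> * (b \<bullet> gradient (g (X 0 \<omega>)) \<theta>)\<^sup>2)"
      by (intro AE_I2) (auto intro: order_trans[OF _ abs_ge_self])
  qed simp
qed

lemma gradient_integrable: "integrable M (\<lambda>\<omega>. gradient (g (X 0 \<omega>)) \<theta>)"
proof -
  have "integrable M (\<lambda>\<omega>. norm (gradient (g (X 0 \<omega>)) \<theta>))"
    by (rule square_integrable_imp_integrable[OF _ gradient_square_integrable]) simp
  then show ?thesis by (simp add: integrable_norm_iff)
qed

lemma gradient_mean_consistent:
  "conv_in_prob_zero M (\<lambda>n \<omega>. (1 / real n) *\<^sub>R (\<Sum>i=1..n. gradient (g (X i \<omega>)) \<theta> - B))"
proof -
  have sq: "integrable M (\<lambda>\<omega>. (norm (gradient (g (X 0 \<omega>)) \<theta> - B))\<^sup>2)"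
  proof (rule Bochner_Integration.integrable_bound)
    show "integrable M (\<lambda>\<omega>. 2 * (norm (gradient (g (X 0 \<omega>)) \<theta>))\<^sup>2 + 2 * (norm B)\<^sup>2)"
      using gradient_square_integrable by simp
    have "(norm (x - B))\<^sup>2 \<le> 2 * (norm x)\<^sup>2 + 2 * (norm B)\<^sup>2" for x
    proof -
      \<comment> \<open>Parallelogram law; dropping the nonnegative term with x + B gives the
        majorant.\<close>
      have "(norm (x - B))\<^sup>2 + (norm (x + B))\<^sup>2 = 2 * (norm x)\<^sup>2 + 2 * (norm B)\<^sup>2"
        by (simp add: power2_norm_eq_inner inner_add inner_diff algebra_simps)
      then show ?thesis using zero_le_power2[of "norm (x + B)"] by linarith
    qed
    then show "AE \<omega> in M. norm ((norm (gradient (g (X 0 \<omega>)) \<theta> - B))\<^sup>2) \<le>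
        norm (2 * (norm (gradient (g (X 0 \<omega>)) \<theta>))\<^sup>2 + 2 * (norm B)\<^sup>2)"
      by (intro AE_I2) simp
  qed simp
  have "expectation (\<lambda>\<omega>. gradient (g (X 0 \<omega>)) \<theta> - B) = 0"
    using gradient_integrable by (simp add: B_eq prob_space)
  then show ?thesis
    using weak_law_of_large_numbers[of "\<lambda>p. gradient (g (fst p)) \<theta> - B"] sq by simp
qed

lemma expectation_label:
  "expectation (Y 0) = expectation (\<lambda>\<omega>. g (X 0 \<omega>) \<theta>)"
proof -
  let ?D = "{\<omega> \<in> space M. Y 0 \<omega> = 1}"
  have "expectation (Y 0) = expectation (\<lambda>\<omega>. indicator ?D \<omega> * 1)"
    by (rule Bochner_Integration.integral_cong) (use indicator_label in auto)
  also have "\<dots> = expectation (\<lambda>\<omega>. g (X 0 \<omega>) \<theta> * 1)"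
  proof (rule cond_prob_integral(2)[where N = borel and X = "X 0" and h = "\<lambda>x. g x \<theta>" and k = "\<lambda>_. 1"])
    show "0 \<le> g x \<theta>" "g x \<theta> \<le> 1" for x using g_bounds[of \<theta> x] by auto
  qed (auto simp: cond_prob_label)
  finally show ?thesis by simp
qed

text \<open>The row vector B^T A^(-1) read as a vector: the coefficient of the score in the
  expansion of the estimator.\<close>

definition score_coeff :: "real^'p" where
  "score_coeff = B v* matrix_inv A"

lemma score_coeff_inner: "B \<bullet> (matrix_inv A *v s) = score_coeff \<bullet> s"
  unfolding score_coeff_def by (rule dot_lmul_matrix[symmetric])

text \<open>As A is symmetric, it maps this coefficient vector to B. The left side is the second
  moment of the score in this direction, so this is where B^T A^(-1) B enters the variance.\<close>

lemma score_coeff_quadratic: "score_coeff \<bullet> (A *v score_coeff) = B \<bullet> (matrix_inv A *v B)"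
proof -
  have "A *v score_coeff = B"
  proof -
    have "score_coeff = transpose (matrix_inv A) *v B"
      unfolding score_coeff_def by simp
    then have "A *v score_coeff = (transpose A ** transpose (matrix_inv A)) *v B"
      by (simp only: A_symmetric matrix_vector_mul_assoc)
    also have "transpose A ** transpose (matrix_inv A) = transpose (matrix_inv A ** A)"
      by (simp add: matrix_transpose_mul)
    also have "matrix_inv A ** A = mat 1"
      using A_invertible unfolding invertible_def matrix_inv_def by (rule someI2_ex) simp
    finally show ?thesis by simp
  qed
  then show ?thesis by (simp add: score_coeff_inner)
qed

end

section \<open>The plug-in estimator\<close>

locale plug_in_estimator = semiparametric_sample M X Y g \<Theta> U \<theta> A B
  for M :: "'a measure" and X :: "nat \<Rightarrow> 'a \<Rightarrow> real^'f::finite" and Y :: "nat \<Rightarrow> 'a \<Rightarrow> real"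
    and g :: "real^'f \<Rightarrow> real^'p::finite \<Rightarrow> real"
    and \<Theta> U :: "(real^'p) set" and \<theta> :: "real^'p" and A :: "real^'p^'p" and B :: "real^'p" +
  fixes r :: "nat \<Rightarrow> nat" and \<gamma> :: real and \<theta>hat :: "nat \<Rightarrow> 'a \<Rightarrow> real^'p"
  assumes r_le: "\<And>n. r n \<le> n"
    and r_ratio: "(\<lambda>n. real (r n) / real n) \<longlonglongrightarrow> \<gamma>" and gamma_pos: "0 < \<gamma>"
    and estimator_measurable: "\<And>n. \<theta>hat n \<in> measurable M (restrict_space borel \<Theta>)"
    and linear_representation: "conv_in_prob_zero M (\<lambda>n \<omega>.
            sqrt (real (r n)) *\<^sub>R (\<theta>hat n \<omega> - \<theta>) -
            (1 / sqrt (real (r n))) *\<^sub>R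
              (matrix_inv A *v (\<Sum>i=1..r n. score g (X i \<omega>) (Y i \<omega>) \<theta>)))"
begin

lemma estimator_measurable_borel [measurable]: "random_variable borel (\<theta>hat n)"
  using estimator_measurable[of n] by (simp add: measurable_restrict_space2_iff)

lemma g_estimator_measurable [measurable]: "random_variable borel (\<lambda>\<omega>. g (X i \<omega>) (\<theta>hat n \<omega>))"
  by (rule g_measurable_compose[OF XY_measurable(1) estimator_measurable])

text \<open>A positive limit of r / n forces labels to exist for large n; only then is division by r
  or sqrt r meaningful.\<close>

lemma eventually_r_pos: "\<forall>\<^sub>F n in sequentially. 0 < r n \<and> 0 < n"
proof -
  have "\<forall>\<^sub>F n in sequentially. 0 < real (r n) / real n"
    using r_ratio gamma_pos by (rule order_tendstoD)
  then show ?thesis by eventually_elim (auto simp: zero_less_divide_iff)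
qed

lemma inverse_ratio: "(\<lambda>n. real n / real (r n)) \<longlonglongrightarrow> 1 / \<gamma>"
  using tendsto_inverse[OF r_ratio] gamma_pos by (simp add: inverse_eq_divide)

lemma sqrt_ratio: "(\<lambda>n. sqrt (real n) / sqrt (real (r n))) \<longlonglongrightarrow> sqrt (1 / \<gamma>)"
  using tendsto_real_sqrt[OF inverse_ratio] by (simp add: real_sqrt_divide)

lemma matrix_measurable [measurable]: "(\<lambda>x. m *v x) \<in> borel_measurable borel" for m :: "real^'p^'p"
  by (intro borel_measurable_continuous_onI matrix_vector_mult_linear_continuous_on)

text \<open>At rate sqrt r the deviation is an o_P(1) term plus a fixed matrix applied to the normed
  score sum, which has bounded second moment. The rate changes to sqrt n because sqrt n / sqrt r
  converges and so is eventually below its limit plus 1.\<close>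

lemma estimator_bounded_in_prob:
  "bounded_in_prob M (\<lambda>n \<omega>. sqrt (real n) *\<^sub>R (\<theta>hat n \<omega> - \<theta>))"
proof -
  let ?sum = "\<lambda>n \<omega>. \<Sum>i=1..r n. score g (X i \<omega>) (Y i \<omega>) \<theta>"
  let ?lead = "\<lambda>n \<omega>. (1 / sqrt (real (r n))) *\<^sub>R (matrix_inv A *v ?sum n \<omega>)"
  let ?rem = "\<lambda>n \<omega>. sqrt (real (r n)) *\<^sub>R (\<theta>hat n \<omega> - \<theta>) - ?lead n \<omega>"
  have sum: "bounded_in_prob M (\<lambda>n \<omega>. (1 / sqrt (real (r n))) *\<^sub>R ?sum n \<omega>)"
    using bounded_in_prob_sum[of "\<lambda>p. score g (fst p) (snd p) \<theta>" r r]
      score_square_integrable score_vector_mean by simp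
  obtain K where K: "K > 0" "\<And>x. norm (matrix_inv A *v x) \<le> K * norm x"
    using bounded_linear.pos_bounded[OF matrix_vector_mul_bounded_linear[of "matrix_inv A"]]
    by (auto simp: mult.commute)
  have lead: "bounded_in_prob M ?lead"
  proof (rule bounded_in_prob_le[OF _ sum K(1)])
    have "norm ((1 / sqrt (real (r n))) *\<^sub>R (matrix_inv A *v x)) \<le>
        K * norm ((1 / sqrt (real (r n))) *\<^sub>R x)" for n x
      using mult_left_mono[OF K(2)[of x], of "\<bar>1 / sqrt (real (r n))\<bar>"] by (simp add: mult_ac)
    then show "\<forall>\<^sub>F n in sequentially. \<forall>\<omega>\<in>space M. norm (?lead n \<omega>) \<le>
        K * norm ((1 / sqrt (real (r n))) *\<^sub>R ?sum n \<omega>)"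
      by (intro always_eventually) blast
  qed simp
  have "bounded_in_prob M (\<lambda>n \<omega>. ?rem n \<omega> + ?lead n \<omega>)"
    by (rule bounded_in_prob_add) (use lead conv_in_prob_zero_imp_bounded[OF linear_representation] in auto)
  then have *: "bounded_in_prob M (\<lambda>n \<omega>. sqrt (real (r n)) *\<^sub>R (\<theta>hat n \<omega> - \<theta>))" by simp
  show ?thesis
  proof (rule bounded_in_prob_le[OF _ *])
    show "0 < sqrt (1 / \<gamma>) + 1" using gamma_pos by (simp add: add_pos_pos)
    have "\<forall>\<^sub>F n in sequentially. sqrt (real n) / sqrt (real (r n)) < sqrt (1 / \<gamma>) + 1"
      by (rule order_tendstoD(2)[OF sqrt_ratio]) simp
    then show "\<forall>\<^sub>F n in sequentially. \<forall>\<omega>\<in>space M. norm (sqrt (real n) *\<^sub>R (\<theta>hat n \<omega> - \<theta>)) \<le>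
        (sqrt (1 / \<gamma>) + 1) * norm (sqrt (real (r n)) *\<^sub>R (\<theta>hat n \<omega> - \<theta>))"
      using eventually_r_pos
    proof eventually_elim
      case (elim n)
      then have "sqrt (real n) \<le> (sqrt (1 / \<gamma>) + 1) * sqrt (real (r n))"
        by (simp add: divide_less_eq)
      then show ?case
        using mult_right_mono[OF _ norm_ge_zero] by (fastforce simp: mult.assoc[symmetric])
    qed
  qed simp
qed

lemma estimator_consistent: "conv_in_prob_zero M (\<lambda>n \<omega>. \<theta>hat n \<omega> - \<theta>)"
proof (rule conv_in_prob_zero_mult_bounded[OF _ _ _ estimator_bounded_in_prob])
  show "conv_in_prob_zero M (\<lambda>n \<omega>. 1 / sqrt (real n))"
    by (rule conv_in_prob_zero_const) real_asymp
  show "\<forall>\<^sub>F n in sequentially. \<forall>\<omega>\<in>space M. norm (\<theta>hat n \<omega> - \<theta>) \<le>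
      norm (1 / sqrt (real n)) * norm (sqrt (real n) *\<^sub>R (\<theta>hat n \<omega> - \<theta>))"
    using eventually_gt_at_top[of 0] by eventually_elim simp
qed simp_all

section \<open>The first-order Taylor remainder\<close>

definition remainder :: "'a \<Rightarrow> nat \<Rightarrow> nat \<Rightarrow> real" where
  "remainder \<omega> n i = g (X i \<omega>) (\<theta>hat n \<omega>) - g (X i \<omega>) \<theta> -
     (\<theta>hat n \<omega> - \<theta>) \<bullet> gradient (g (X i \<omega>)) \<theta>"

lemma remainder_measurable [measurable]: "(\<lambda>\<omega>. remainder \<omega> n i) \<in> borel_measurable M"
  unfolding remainder_def by measurable

text \<open>Once \<open>\<theta>hat\<close> lies in the ball, each ratio is at most H(X_i), a
  function free of \<open>\<theta>hat\<close>; this removes the dependence between the estimator and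
  the sample. The normalisation by the distance is what later pairs with sqrt n times that
  distance.\<close>

lemma average_remainder_ratio:
  "conv_in_prob_zero M (\<lambda>n \<omega>. 1 / real n * ((\<Sum>i=1..n. \<bar>remainder \<omega> n i\<bar>) / norm (\<theta>hat n \<omega> - \<theta>)))"
  (is "conv_in_prob_zero M ?Q")
  unfolding conv_in_prob_zero_iff
proof (intro allI impI)
  fix \<epsilon> e :: real assume "\<epsilon> > 0" "e > 0"
  have g_meas: "(\<lambda>t. g t \<eta>) \<in> borel_measurable borel" if "\<eta> \<in> U" for \<eta>
    using that U by (intro g_measurable_fixed) auto
  \<comment> \<open>Markov's inequality will divide the integral of H by \<epsilon>, leaving e / 2;
    the other half of e is spent on the event that \<open>\<theta>hat\<close> is far from
    \<open>\<theta>\<close>.\<close>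
  have pos: "\<epsilon> * (e / 2) > 0" using \<open>\<epsilon> > 0\<close> \<open>e > 0\<close> by simp
  obtain \<delta> H where \<delta>: "\<delta> > 0" "ball \<theta> \<delta> \<subseteq> U" and H [measurable]: "H \<in> borel_measurable borel"
    and H_int: "(\<integral>\<^sup>+\<omega>. H (X 0 \<omega>) \<partial>M) < ennreal (\<epsilon> * (e / 2))"
    and H_le: "\<And>t \<eta>. \<eta> \<in> ball \<theta> \<delta> \<Longrightarrow> ennreal (norm (gradient (g t) \<eta> - gradient (g t) \<theta>)) \<le> H t"
    using gradient_modulus_exists[OF U(1,2) g_diff g_cont g_meas XY_measurable(1) gradient_dominated pos]
    by blast
  have rem: "ennreal (\<bar>remainder \<omega> n i\<bar> / norm (\<theta>hat n \<omega> - \<theta>)) \<le> H (X i \<omega>)"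
    if "norm (\<theta>hat n \<omega> - \<theta>) < \<delta>" for \<omega> n i
  \<comment> \<open>Both exceptional cases are trivial: the bound is infinite, or the ratio is 0
    because division by zero gives 0.\<close>
  proof (cases "H (X i \<omega>) = \<infinity> \<or> \<theta>hat n \<omega> = \<theta>")
    case False
    then obtain K where K: "H (X i \<omega>) = ennreal K" "K \<ge> 0"
      by (cases "H (X i \<omega>)") auto
    have "\<bar>remainder \<omega> n i\<bar> \<le> K * norm (\<theta>hat n \<omega> - \<theta>)"
      unfolding remainder_def
    proof (rule GDERIV_first_order_bound)
      fix z assume z: "z \<in> ball \<theta> \<delta>"
      then show "GDERIV (g (X i \<omega>)) z :> gradient (g (X i \<omega>)) z"
        using g_diff U(1) \<delta>(2) by (intro GDERIV_gradient) (auto simp: differentiable_on_eq_differentiable_at)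
      show "norm (gradient (g (X i \<omega>)) z - gradient (g (X i \<omega>)) \<theta>) \<le> K"
        using H_le[OF z, of "X i \<omega>"] K by simp
    next
      show "\<theta>hat n \<omega> \<in> ball \<theta> \<delta>" using that by (simp add: dist_norm norm_minus_commute)
    qed
    then show ?thesis using False K by (auto intro!: ennreal_leI simp: divide_le_eq)
  qed auto
  \<comment> \<open>Half the radius, so that the complement of this strict inequality still lies
    inside the open ball.\<close>
  have "\<forall>\<^sub>F n in sequentially. measure M {\<omega> \<in> space M. norm (\<theta>hat n \<omega> - \<theta>) > \<delta> / 2} < e / 2"
    using estimator_consistent \<delta>(1) \<open>e > 0\<close> unfolding conv_in_prob_zero_iff by (meson half_gt_zero)
  then show "\<forall>\<^sub>F n in sequentially. measure M {\<omega> \<in> space M. norm (?Q n \<omega>) > \<epsilon>} < e"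
    using eventually_gt_at_top[of 0]
  proof eventually_elim
    case (elim n)
    let ?far = "{\<omega> \<in> space M. norm (\<theta>hat n \<omega> - \<theta>) > \<delta> / 2}"
    let ?large = "{\<omega> \<in> space M. ennreal (real n * \<epsilon>) \<le> (\<Sum>i=1..n. H (X i \<omega>))}"
    have meas: "?far \<in> sets M" "?large \<in> sets M" by measurable
    have "{\<omega> \<in> space M. norm (?Q n \<omega>) > \<epsilon>} \<subseteq> ?far \<union> ?large"
    proof (rule subsetI, rule ccontr)
      fix \<omega> assume \<omega>: "\<omega> \<in> {\<omega> \<in> space M. norm (?Q n \<omega>) > \<epsilon>}" and "\<omega> \<notin> ?far \<union> ?large"
      then have near: "norm (\<theta>hat n \<omega> - \<theta>) < \<delta>" and "\<omega> \<notin> ?large" using \<delta>(1) by auto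
      have Q_norm: "norm (?Q n \<omega>) = ?Q n \<omega>"
        by (simp add: sum_nonneg)
      have "real n * \<epsilon> \<le> (\<Sum>i=1..n. \<bar>remainder \<omega> n i\<bar> / norm (\<theta>hat n \<omega> - \<theta>))"
      proof -
        have scale: "real n * \<epsilon> \<le> x" if "\<epsilon> < 1 / real n * x" for x
          using that elim(2) by (simp add: field_simps)
        have "\<epsilon> < norm (?Q n \<omega>)" using \<omega> by blast
        then have "\<epsilon> < ?Q n \<omega>" unfolding Q_norm .
        then show ?thesis unfolding sum_divide_distrib[symmetric] by (rule scale)
      qed
      then have "ennreal (real n * \<epsilon>) \<le> ennreal (\<Sum>i=1..n. \<bar>remainder \<omega> n i\<bar> / norm (\<theta>hat n \<omega> - \<theta>))"
        by (rule ennreal_leI)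
      also have "\<dots> = (\<Sum>i=1..n. ennreal (\<bar>remainder \<omega> n i\<bar> / norm (\<theta>hat n \<omega> - \<theta>)))"
        by (rule sum_ennreal[symmetric]) simp
      also have "\<dots> \<le> (\<Sum>i=1..n. H (X i \<omega>))"
        by (intro sum_mono rem near)
      finally show False using \<open>\<omega> \<notin> ?large\<close> \<omega> by simp
    qed
    then have "measure M {\<omega> \<in> space M. norm (?Q n \<omega>) > \<epsilon>} \<le> measure M (?far \<union> ?large)"
      using meas by (intro finite_measure_mono) auto
    also have "\<dots> \<le> measure M ?far + measure M ?large"
      using meas by (intro measure_Un_le)
    also have "measure M ?large \<le> e / 2"
    proof -
      have "emeasure M ?large \<le> ennreal (1 / \<epsilon>) * (\<integral>\<^sup>+\<omega>. H (X 0 \<omega>) \<partial>M)"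
        using emeasure_sum_ge_le[of "\<lambda>p. H (fst p)" \<epsilon> n] \<open>\<epsilon> > 0\<close> elim(2) by simp
      also have "\<dots> \<le> ennreal (1 / \<epsilon>) * ennreal (\<epsilon> * (e / 2))"
        using H_int by (intro mult_left_mono) auto
      also have "\<dots> = ennreal (e / 2)"
        using \<open>\<epsilon> > 0\<close> \<open>e > 0\<close> by (simp add: ennreal_mult''[symmetric])
      finally show ?thesis
        using \<open>e > 0\<close> by (simp add: emeasure_eq_measure)
    qed
    finally show ?case using elim(1) by simp
  qed
qed

text \<open>The factor 1 / n times sqrt n supplies 1 / sqrt n, and the distance cancels; at
  \<open>\<theta>hat = \<theta>\<close>, where it cannot be cancelled, the remainder is 0.\<close>

lemma remainder_negligible:
  "conv_in_prob_zero M (\<lambda>n \<omega>. 1 / sqrt (real n) * (\<Sum>i=1..n. remainder \<omega> n i))"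
proof (rule conv_in_prob_zero_mult_bounded[OF _ _ average_remainder_ratio estimator_bounded_in_prob])
  show "\<forall>\<^sub>F n in sequentially. \<forall>\<omega>\<in>space M. norm (1 / sqrt (real n) * (\<Sum>i=1..n. remainder \<omega> n i)) \<le>
      norm (1 / real n * ((\<Sum>i=1..n. \<bar>remainder \<omega> n i\<bar>) / norm (\<theta>hat n \<omega> - \<theta>))) *
      norm (sqrt (real n) *\<^sub>R (\<theta>hat n \<omega> - \<theta>))"
    using eventually_gt_at_top[of 0]
  proof (eventually_elim, intro ballI)
    fix n :: nat and \<omega> assume "0 < n"
    have "sqrt (real n) / real n = 1 / sqrt (real n)"
      using \<open>0 < n\<close> by (simp add: real_div_sqrt field_simps)
    moreover have "norm (1 / real n * ((\<Sum>i=1..n. \<bar>remainder \<omega> n i\<bar>) / norm (\<theta>hat n \<omega> - \<theta>))) *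
        norm (sqrt (real n) *\<^sub>R (\<theta>hat n \<omega> - \<theta>)) =
        sqrt (real n) / real n * (\<Sum>i=1..n. \<bar>remainder \<omega> n i\<bar>)"
      if "\<theta>hat n \<omega> \<noteq> \<theta>" using that by (simp add: sum_nonneg mult.commute)
    moreover have "(\<Sum>i=1..n. remainder \<omega> n i) = 0" if "\<theta>hat n \<omega> = \<theta>"
      using that by (simp add: remainder_def)
    ultimately show "norm (1 / sqrt (real n) * (\<Sum>i=1..n. remainder \<omega> n i)) \<le>
      norm (1 / real n * ((\<Sum>i=1..n. \<bar>remainder \<omega> n i\<bar>) / norm (\<theta>hat n \<omega> - \<theta>))) *
      norm (sqrt (real n) *\<^sub>R (\<theta>hat n \<omega> - \<theta>))"
      by (cases "\<theta>hat n \<omega> = \<theta>") (auto simp: divide_right_mono)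
  qed
qed measurable

section \<open>Linearization of the estimator\<close>

definition influence :: "nat \<Rightarrow> 'a \<Rightarrow> real" where
  "influence i \<omega> = score_coeff \<bullet> score g (X i \<omega>) (Y i \<omega>) \<theta>"

text \<open>Written as one sum with a case distinction, to match
  \<open>char_two_block_sum_tendsto\<close>. The constant 1 / \<gamma> in place of n / r makes the
  summand functions independent of n.\<close>

definition linear_part :: "nat \<Rightarrow> 'a \<Rightarrow> real" where
  "linear_part n \<omega> = 1 / sqrt (real n) *
     (\<Sum>i=1..n. if i \<le> r n then (g (X i \<omega>) \<theta> - expectation (Y 0)) + influence i \<omega> / \<gamma>
        else g (X i \<omega>) \<theta> - expectation (Y 0))"

lemma influence_measurable [measurable]: "random_variable borel (influence i)"
  unfolding influence_def by measurable

lemma linear_part_measurable [measurable]: "random_variable borel (linear_part n)"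
  unfolding linear_part_def by measurable

lemma linear_part_eq:
  "linear_part n \<omega> = 1 / sqrt (real n) * ((\<Sum>i=1..n. g (X i \<omega>) \<theta> - expectation (Y 0)) +
     (\<Sum>i=1..r n. influence i \<omega>) / \<gamma>)"
proof -
  have "(\<Sum>i=1..n. if i \<le> r n then (g (X i \<omega>) \<theta> - expectation (Y 0)) + influence i \<omega> / \<gamma>
        else g (X i \<omega>) \<theta> - expectation (Y 0)) =
      (\<Sum>i=1..n. (g (X i \<omega>) \<theta> - expectation (Y 0)) + (if i \<le> r n then influence i \<omega> / \<gamma> else 0))"
    by (rule sum.cong) auto
  also have "\<dots> = (\<Sum>i=1..n. g (X i \<omega>) \<theta> - expectation (Y 0)) +
      (\<Sum>i\<in>{1..n} \<inter> {i. i \<le> r n}. influence i \<omega> / \<gamma>)"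
    by (simp add: sum.distrib sum.If_cases)
  also have "{1..n} \<inter> {i. i \<le> r n} = {1..r n}" using r_le[of n] by auto
  finally show ?thesis unfolding linear_part_def by (simp add: sum_divide_distrib)
qed

text \<open>The last two terms are the errors made by replacing \<open>\<surd>n B\<^sup>T(\<theta>hat - \<theta>)\<close> by its linear
  representation and \<open>n / r\<close> by its limit.\<close>

lemma estimator_decomposition:
  assumes "0 < r n" "0 < n"
  shows "sqrt (real n) * (1 / real n * (\<Sum>i=1..n. g (X i \<omega>) (\<theta>hat n \<omega>)) - expectation (Y 0)) -
      linear_part n \<omega> =
    1 / sqrt (real n) * (\<Sum>i=1..n. remainder \<omega> n i) +
    (sqrt (real n) *\<^sub>R (\<theta>hat n \<omega> - \<theta>)) \<bullet>
      ((1 / real n) *\<^sub>R (\<Sum>i=1..n. gradient (g (X i \<omega>)) \<theta> - B)) +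
    (sqrt (real n) / sqrt (real (r n))) * (B \<bullet>
      (sqrt (real (r n)) *\<^sub>R (\<theta>hat n \<omega> - \<theta>) - (1 / sqrt (real (r n))) *\<^sub>R
              (matrix_inv A *v (\<Sum>i=1..r n. score g (X i \<omega>) (Y i \<omega>) \<theta>)))) +
    (real n / real (r n) - 1 / \<gamma>) * (1 / sqrt (real n) * (\<Sum>i=1..r n. influence i \<omega>))"
proof -
  \<comment> \<open>With n = s * s, r = u * u and every sum named, the claim becomes a rational
    identity in s, u and \<gamma>.\<close>
  define s where "s = sqrt (real n)"
  define u where "u = sqrt (real (r n))"
  have s: "s > 0" "real n = s * s" and u: "u > 0" "real (r n) = u * u"
    using assms by (auto simp: s_def u_def)
  define d where "d = \<theta>hat n \<omega> - \<theta>"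
  define G where "G = (\<Sum>i=1..n. gradient (g (X i \<omega>)) \<theta>)"
  define h where "h = (\<Sum>i=1..n. g (X i \<omega>) \<theta>)"
  define R where "R = (\<Sum>i=1..n. remainder \<omega> n i)"
  define I where "I = (\<Sum>i=1..r n. influence i \<omega>)"
  define q where "q = expectation (Y 0)"
  have sum_g: "(\<Sum>i=1..n. g (X i \<omega>) (\<theta>hat n \<omega>)) = h + R + d \<bullet> G"
  proof -
    have "(\<Sum>i=1..n. g (X i \<omega>) (\<theta>hat n \<omega>)) =
        (\<Sum>i=1..n. g (X i \<omega>) \<theta> + remainder \<omega> n i + d \<bullet> gradient (g (X i \<omega>)) \<theta>)"
      by (simp add: remainder_def d_def)
    then show ?thesis by (simp add: sum.distrib h_def R_def G_def inner_sum_right)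
  qed
  have sum_grad: "(\<Sum>i=1..n. gradient (g (X i \<omega>)) \<theta> - B) = G - real n *\<^sub>R B"
    by (simp add: sum_subtractf G_def scaleR_conv_of_real sum_constant_scaleR)
  have sum_h: "(\<Sum>i=1..n. g (X i \<omega>) \<theta> - q) = h - real n * q"
    by (simp add: sum_subtractf h_def)
  have infl: "B \<bullet> (matrix_inv A *v (\<Sum>i=1..r n. score g (X i \<omega>) (Y i \<omega>) \<theta>)) = I"
    by (simp add: score_coeff_inner inner_sum_right I_def influence_def)
  show ?thesis
    unfolding linear_part_eq sum_g sum_grad d_def[symmetric] q_def[symmetric] sum_h
      R_def[symmetric] I_def[symmetric] s_def[symmetric] u_def[symmetric]
      inner_diff_right inner_scaleR_right inner_scaleR_left infl s(2) u(2)
    using s(1) u(1) gamma_pos by (simp add: field_simps inner_commute)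
qed

lemma influence_bounded: "bounded_in_prob M (\<lambda>n \<omega>. 1 / sqrt (real n) * (\<Sum>i=1..r n. influence i \<omega>))"
  using bounded_in_prob_sum[of "\<lambda>p. score_coeff \<bullet> score g (fst p) (snd p) \<theta>" r "\<lambda>n. n"]
    score_moments(1)[of score_coeff] score_mean[of score_coeff] r_le by (simp add: influence_def)

text \<open>Each of the four error terms is null: the remainder outright; the centred mean gradient
  tends to 0 against a bounded deviation; the error of the linear representation tends to 0 against
  a convergent coefficient; and n / r - 1 / \<gamma> tends to 0 against a bounded influence
  sum.\<close>

lemma linearization:
  "conv_in_prob_zero M (\<lambda>n \<omega>.
     sqrt (real n) * (1 / real n * (\<Sum>i=1..n. g (X i \<omega>) (\<theta>hat n \<omega>)) - expectation (Y 0)) -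
     linear_part n \<omega>)" (is "conv_in_prob_zero M ?diff")
proof -
  let ?T1 = "\<lambda>n \<omega>. 1 / sqrt (real n) * (\<Sum>i=1..n. remainder \<omega> n i)"
  let ?avg = "\<lambda>n \<omega>. (1 / real n) *\<^sub>R (\<Sum>i=1..n. gradient (g (X i \<omega>)) \<theta> - B)"
  let ?dev = "\<lambda>n \<omega>. sqrt (real n) *\<^sub>R (\<theta>hat n \<omega> - \<theta>)"
  let ?rem = "\<lambda>n \<omega>. sqrt (real (r n)) *\<^sub>R (\<theta>hat n \<omega> - \<theta>) - (1 / sqrt (real (r n))) *\<^sub>R
              (matrix_inv A *v (\<Sum>i=1..r n. score g (X i \<omega>) (Y i \<omega>) \<theta>))"
  let ?T3 = "\<lambda>n \<omega>. (sqrt (real n) / sqrt (real (r n))) * (B \<bullet> ?rem n \<omega>)"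
  let ?T4 = "\<lambda>n \<omega>. (real n / real (r n) - 1 / \<gamma>) * (1 / sqrt (real n) * (\<Sum>i=1..r n. influence i \<omega>))"
  have T2: "conv_in_prob_zero M (\<lambda>n \<omega>. ?dev n \<omega> \<bullet> ?avg n \<omega>)"
  proof (rule conv_in_prob_zero_mult_bounded[OF _ _ gradient_mean_consistent estimator_bounded_in_prob])
    have "norm (?dev n \<omega> \<bullet> ?avg n \<omega>) \<le> norm (?avg n \<omega>) * norm (?dev n \<omega>)" for n \<omega>
      using Cauchy_Schwarz_ineq2[of "?dev n \<omega>" "?avg n \<omega>"] by (simp only: real_norm_def mult.commute)
    then show "\<forall>\<^sub>F n in sequentially. \<forall>\<omega>\<in>space M. norm (?dev n \<omega> \<bullet> ?avg n \<omega>) \<le>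
        norm (?avg n \<omega>) * norm (?dev n \<omega>)"
      by (intro always_eventually) blast
  qed measurable
  have T3: "conv_in_prob_zero M ?T3"
  proof (rule conv_in_prob_zero_mult_bounded[OF _ _ linear_representation])
    show "bounded_in_prob M (\<lambda>n \<omega>. (sqrt (real n) / sqrt (real (r n))) *\<^sub>R B)"
      by (rule bounded_in_prob_const[OF tendsto_scaleR[OF sqrt_ratio tendsto_const]])
    have "norm (c * (B \<bullet> x)) \<le> norm x * norm (c *\<^sub>R B)" for c x
      using mult_left_mono[OF Cauchy_Schwarz_ineq2[of B x], of "\<bar>c\<bar>"] by (simp add: abs_mult mult_ac)
    then show "\<forall>\<^sub>F n in sequentially. \<forall>\<omega>\<in>space M. norm (?T3 n \<omega>) \<le>
        norm (?rem n \<omega>) * norm ((sqrt (real n) / sqrt (real (r n))) *\<^sub>R B)"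
      by (intro always_eventually) blast
  qed measurable
  have T4: "conv_in_prob_zero M ?T4"
  proof (rule conv_in_prob_zero_mult_bounded[OF _ _ _ influence_bounded])
    show "conv_in_prob_zero M (\<lambda>n \<omega>. real n / real (r n) - 1 / \<gamma>)"
      using tendsto_diff[OF inverse_ratio tendsto_const, of "1 / \<gamma>"] by (intro conv_in_prob_zero_const) simp
  qed (auto simp: abs_mult)
  have sum: "conv_in_prob_zero M (\<lambda>n \<omega>. ?T1 n \<omega> + ?dev n \<omega> \<bullet> ?avg n \<omega> + ?T3 n \<omega> + ?T4 n \<omega>)"
    by (intro conv_in_prob_zero_add remainder_negligible T2 T3 T4) measurable
  show ?thesis
  \<comment> \<open>The decomposition holds only once r and n are positive, so the eventual equality
    is passed on as domination with the constant factor 1.\<close>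
  proof (rule conv_in_prob_zero_mult_bounded[OF _ _ sum bounded_in_prob_const[OF tendsto_const]])
    show "\<forall>\<^sub>F n in sequentially. \<forall>\<omega>\<in>space M. norm (?diff n \<omega>) \<le>
      norm (?T1 n \<omega> + ?dev n \<omega> \<bullet> ?avg n \<omega> + ?T3 n \<omega> + ?T4 n \<omega>) * norm (1::real)"
      using eventually_r_pos
    proof (eventually_elim, intro ballI)
      fix n \<omega> assume "0 < r n \<and> 0 < n"
      then show "norm (?diff n \<omega>) \<le> norm (?T1 n \<omega> + ?dev n \<omega> \<bullet> ?avg n \<omega> + ?T3 n \<omega> + ?T4 n \<omega>) * norm (1::real)"
        by (simp only: estimator_decomposition norm_one mult_1_right order_refl)
    qed
  qed measurable
qed

section \<open>The limiting variance and weak convergence\<close>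

definition limit_variance :: real where
  "limit_variance = variance (\<lambda>\<omega>. g (X 0 \<omega>) \<theta>) + 1 / \<gamma> * (B \<bullet> (matrix_inv A *v B))"

text \<open>The form B^T A^(-1) B is the second moment of the score in the direction
  \<open>score_coeff\<close>.\<close>

lemma limit_variance_nonneg: "0 \<le> limit_variance"
proof -
  have "0 \<le> expectation (\<lambda>\<omega>. (score_coeff \<bullet> score g (X 0 \<omega>) (Y 0 \<omega>) \<theta>)\<^sup>2)"
    by simp
  then have "0 \<le> B \<bullet> (matrix_inv A *v B)"
    unfolding score_moments(2) score_coeff_quadratic .
  then show ?thesis
    unfolding limit_variance_def using gamma_pos by (intro add_nonneg_nonneg) auto
qed

lemma char_linear_part_tendsto:
  "(\<lambda>n. char (distr M borel (linear_part n)) t) \<longlonglongrightarrow> char (normal_law 0 limit_variance) t"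
proof -
  define q where "q = expectation (Y 0)"
  let ?k = "\<lambda>\<omega>. g (X 0 \<omega>) \<theta> - q" and ?s = "\<lambda>\<omega>. score_coeff \<bullet> score g (X 0 \<omega>) (Y 0 \<omega>) \<theta>"
  have b: "\<bar>g x \<theta>\<bar> \<le> 1" for x using g_bounds[of \<theta> x] by auto
  have kb: "\<bar>g x \<theta> - q\<bar> \<le> 1 + \<bar>q\<bar>" for x using b[of x] by linarith
  have int_g: "integrable M (\<lambda>\<omega>. g (X 0 \<omega>) \<theta>)"
    by (rule integrable_const_bound[where B=1]) (use b in auto)
  have int_k: "integrable M ?k" using int_g by simp
  have mean_k: "expectation ?k = 0"
    using int_g by (simp add: q_def expectation_label prob_space)
  have sq_k: "integrable M (\<lambda>\<omega>. (?k \<omega>)\<^sup>2)"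
    by (rule integrable_const_bound[where B="(1 + \<bar>q\<bar>)\<^sup>2"])
       (use kb in \<open>auto simp: abs_le_square_iff[symmetric]\<close>)
  have sq_s: "integrable M (\<lambda>\<omega>. (?s \<omega>)\<^sup>2)" by (rule score_moments)
  have int_s: "integrable M ?s"
    by (rule square_integrable_imp_integrable[OF _ sq_s]) simp
  have int_sk: "integrable M (\<lambda>\<omega>. ?s \<omega> * ?k \<omega>)"
  proof (rule Bochner_Integration.integrable_bound)
    show "integrable M (\<lambda>\<omega>. (1 + \<bar>q\<bar>) * ?s \<omega>)" using int_s by simp
    have "norm (?s \<omega> * ?k \<omega>) \<le> norm ((1 + \<bar>q\<bar>) * ?s \<omega>)" for \<omega>
      using mult_left_mono[OF kb[of "X 0 \<omega>"] abs_ge_zero[of "?s \<omega>"]] by (simp add: abs_mult mult.commute)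
    then show "AE \<omega> in M. norm (?s \<omega> * ?k \<omega>) \<le> norm ((1 + \<bar>q\<bar>) * ?s \<omega>)" by simp
  qed simp
  have cross: "expectation (\<lambda>\<omega>. ?s \<omega> * ?k \<omega>) = 0"
    using score_moments(3)[of "\<lambda>x. g x \<theta> - q" "1 + \<bar>q\<bar>" score_coeff] kb by simp
  have expand: "(\<lambda>\<omega>. (?k \<omega> + ?s \<omega> / \<gamma>)\<^sup>2) =
      (\<lambda>\<omega>. (?k \<omega>)\<^sup>2 + (?s \<omega>)\<^sup>2 / \<gamma>\<^sup>2 + 2 / \<gamma> * (?s \<omega> * ?k \<omega>))"
    by (simp add: power2_sum power_divide fun_eq_iff mult_ac)
  have sq_f: "integrable M (\<lambda>\<omega>. (?k \<omega> + ?s \<omega> / \<gamma>)\<^sup>2)"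
    unfolding expand using sq_k sq_s int_sk by simp
  have mean_f: "expectation (\<lambda>\<omega>. ?k \<omega> + ?s \<omega> / \<gamma>) = 0"
    using int_k int_s mean_k score_mean[of score_coeff] by simp
  have var_f: "expectation (\<lambda>\<omega>. (?k \<omega> + ?s \<omega> / \<gamma>)\<^sup>2) =
      expectation (\<lambda>\<omega>. (?k \<omega>)\<^sup>2) + (B \<bullet> (matrix_inv A *v B)) / \<gamma>\<^sup>2"
    unfolding expand using sq_k sq_s int_sk cross
    by (simp add: score_moments(2) score_coeff_quadratic)
  have var_k: "expectation (\<lambda>\<omega>. (?k \<omega>)\<^sup>2) = variance (\<lambda>\<omega>. g (X 0 \<omega>) \<theta>)"
    by (simp add: q_def expectation_label)
  \<comment> \<open>With v = Var[g(X, \<theta>)] and Q = B^T A^(-1) B, a labeled summand has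
    variance v + Q / \<gamma>^2 and an unlabeled one v. The block weights \<gamma> and 1 - \<gamma>
    leave v + Q / \<gamma>.\<close>
  have "\<gamma> * expectation (\<lambda>\<omega>. (?k \<omega> + ?s \<omega> / \<gamma>)\<^sup>2) + (1 - \<gamma>) * expectation (\<lambda>\<omega>. (?k \<omega>)\<^sup>2) = limit_variance"
    unfolding var_f var_k limit_variance_def using gamma_pos by (simp add: field_simps power2_eq_square)
  then show ?thesis
    using char_two_block_sum_tendsto[of "\<lambda>p. (g (fst p) \<theta> - q) + (score_coeff \<bullet> score g (fst p) (snd p) \<theta>) / \<gamma>"
        "\<lambda>p. g (fst p) \<theta> - q" r \<gamma> t] sq_f mean_f sq_k mean_k r_le r_ratio
    by (simp add: char_normal_law limit_variance_nonneg linear_part_def[abs_def] influence_def q_def[symmetric]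
        cong: if_cong)
qed

lemma plug_in_weak_conv:
  "weak_conv_m (\<lambda>n. distr M borel (\<lambda>\<omega>.
      sqrt (real n) * (1 / real n * (\<Sum>i=1..n. g (X i \<omega>) (\<theta>hat n \<omega>)) - expectation (Y 0))))
    (normal_law 0 limit_variance)"
proof (rule levy_continuity)
  show "real_distribution (distr M borel (\<lambda>\<omega>.
      sqrt (real n) * (1 / real n * (\<Sum>i=1..n. g (X i \<omega>) (\<theta>hat n \<omega>)) - expectation (Y 0))))" for n
    by (rule real_distribution_distr) measurable
  show "real_distribution (normal_law 0 limit_variance)"
    by (rule real_distribution_normal_law)
  show "(\<lambda>n. char (distr M borel (\<lambda>\<omega>.
      sqrt (real n) * (1 / real n * (\<Sum>i=1..n. g (X i \<omega>) (\<theta>hat n \<omega>)) - expectation (Y 0)))) t)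
    \<longlonglongrightarrow> char (normal_law 0 limit_variance) t" for t
    by (rule char_tendsto_conv_in_prob[OF _ _ linearization char_linear_part_tendsto]) measurable
qed

end

theorem theorem1:
  fixes M :: "'a measure"
    and X :: "nat \<Rightarrow> 'a \<Rightarrow> real^'f::finite"
    and Y :: "nat \<Rightarrow> 'a \<Rightarrow> real"
    and g :: "real^'f \<Rightarrow> real^'p::finite \<Rightarrow> real"
    and \<Theta> U :: "(real^'p) set"
    and \<theta> :: "real^'p"
    and r :: "nat \<Rightarrow> nat" and \<gamma> :: real
    and \<theta>hat :: "nat \<Rightarrow> 'a \<Rightarrow> real^'p"
    and A :: "real^'p^'p" and B :: "real^'p"
  assumes "prob_space M"
    \<comment> \<open>index 0 is the generic pair, indices 1, 2, ... are the sample\<close>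
    and "prob_space.indep_vars M (\<lambda>_. borel \<Otimes>\<^sub>M borel) (\<lambda>i \<omega>. (X i \<omega>, Y i \<omega>)) UNIV"
    and "\<And>i. distr M (borel \<Otimes>\<^sub>M borel) (\<lambda>\<omega>. (X i \<omega>, Y i \<omega>)) =
              distr M (borel \<Otimes>\<^sub>M borel) (\<lambda>\<omega>. (X 0 \<omega>, Y 0 \<omega>))"
    and "\<And>i \<omega>. \<omega> \<in> space M \<Longrightarrow> Y i \<omega> \<in> {0, 1}"
    and "\<And>n. r n \<le> n"
    and "(\<lambda>n. real (r n) / real n) \<longlonglongrightarrow> \<gamma>" and "0 < \<gamma>" and "\<gamma> \<le> 1"
    \<comment> \<open>the semiparametric model\<close>
    and "(\<lambda>(t, \<eta>). g t \<eta>) \<in> borel_measurable (borel \<Otimes>\<^sub>M restrict_space borel \<Theta>)"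
    and "\<And>t \<eta>. \<eta> \<in> \<Theta> \<Longrightarrow> 0 < g t \<eta> \<and> g t \<eta> < 1"
    and "\<theta> \<in> interior \<Theta>"
    and "AE \<omega> in M. real_cond_exp M (vimage_algebra (space M) (X 0) borel)
                       (indicator {\<omega> \<in> space M. Y 0 \<omega> = 1}) \<omega> = g (X 0 \<omega>) \<theta>"
    \<comment> \<open>regularity conditions\<close>
    and "open U" and "convex U" and "\<theta> \<in> U" and "U \<subseteq> \<Theta>"
    and "\<And>t. g t differentiable_on U" and "\<And>t. continuous_on U (gradient (g t))"
    and "(\<integral>\<^sup>+\<omega>. (SUP \<eta>\<in>U. ennreal (norm (gradient (g (X 0 \<omega>)) \<eta>))) \<partial>M) < \<infinity>"
    and "integrable M (\<lambda>\<omega>. info_integrand g (X 0 \<omega>) \<theta>)"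
    and "A = (\<integral>\<omega>. info_integrand g (X 0 \<omega>) \<theta> \<partial>M)" and "invertible A"
    and "B = (\<integral>\<omega>. gradient (g (X 0 \<omega>)) \<theta> \<partial>M)"
    \<comment> \<open>the estimator is a function of the labeled data\<close>
    and "\<And>n. \<exists>T \<in> measurable (\<Pi>\<^sub>M i\<in>{1..r n}. borel \<Otimes>\<^sub>M borel) (restrict_space borel \<Theta>).
              \<forall>\<omega>\<in>space M. \<theta>hat n \<omega> = T (\<lambda>i\<in>{1..r n}. (X i \<omega>, Y i \<omega>))"
    \<comment> \<open>with probability tending to one, the estimator is a root of the estimating equation
        (at a fixed sample size a root need not exist, e.g. if all observed labels coincide)\<close>
    and "\<exists>E. (\<forall>n. E n \<in> sets M) \<and> (\<lambda>n. measure M (E n)) \<longlonglongrightarrow> 1 \<and>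
            (\<forall>n. \<forall>\<omega>\<in>E n. 0 = (\<Sum>i=1..r n. score g (X i \<omega>) (Y i \<omega>) (\<theta>hat n \<omega>)))"
    and "conv_in_prob_zero M (\<lambda>n \<omega>.
            sqrt (real (r n)) *\<^sub>R (\<theta>hat n \<omega> - \<theta>) -
            (1 / sqrt (real (r n))) *\<^sub>R
              (matrix_inv A *v (\<Sum>i=1..r n. score g (X i \<omega>) (Y i \<omega>) \<theta>)))"
  shows "has_asymptotic_variance M
           (\<lambda>n \<omega>. 1 / real n * (\<Sum>i=1..n. g (X i \<omega>) (\<theta>hat n \<omega>)))
           (prob_space.expectation M (Y 0))
           (\<lambda>n. 1 / real n * prob_space.variance M (\<lambda>\<omega>. g (X 0 \<omega>) \<theta>) +
                1 / (real n * \<gamma>) * (B \<bullet> (matrix_inv A *v B)))"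
proof -
  interpret prob_space M by fact
  interpret plug_in_estimator M X Y g \<Theta> U \<theta> A B r \<gamma> \<theta>hat
  proof unfold_locales
    fix n
    have W: "(\<lambda>\<omega>. (X i \<omega>, Y i \<omega>)) \<in> M \<rightarrow>\<^sub>M borel \<Otimes>\<^sub>M borel" for i
      using assms(2) by (auto simp: indep_vars_def)
    obtain T where T: "T \<in> measurable (\<Pi>\<^sub>M i\<in>{1..r n}. borel \<Otimes>\<^sub>M borel) (restrict_space borel \<Theta>)"
      and \<theta>hat: "\<And>\<omega>. \<omega> \<in> space M \<Longrightarrow> \<theta>hat n \<omega> = T (\<lambda>i\<in>{1..r n}. (X i \<omega>, Y i \<omega>))"
      using assms(24)[of n] by blast
    \<comment> \<open>Measurability of the estimator comes from its being a measurable function of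
      the labeled pairs.\<close>
    have "(\<lambda>\<omega>. T (\<lambda>i\<in>{1..r n}. (X i \<omega>, Y i \<omega>))) \<in> measurable M (restrict_space borel \<Theta>)"
      by (rule measurable_compose[OF measurable_restrict T]) (rule W)
    then show "\<theta>hat n \<in> measurable M (restrict_space borel \<Theta>)"
      using \<theta>hat by (simp cong: measurable_cong)
  qed (fact assms)+
  show ?thesis
    unfolding has_asymptotic_variance_def
  proof (intro exI[of _ limit_variance] conjI allI)
    \<comment> \<open>With r identified with n \<gamma> this is an exact identity; at n = 0 both
      sides are 0 by the convention for division.\<close>
    show "1 / real n * variance (\<lambda>\<omega>. g (X 0 \<omega>) \<theta>) + 1 / (real n * \<gamma>) * (B \<bullet> (matrix_inv A *v B)) =
        limit_variance / real n" for n
      by (simp add: limit_variance_def add_divide_distrib mult.commute)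
  qed (fact limit_variance_nonneg plug_in_weak_conv)+
qed

end
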